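(* Let $q$ be a prime power and let $\alpha$ be Haar-random in $\mathfrak p=t^{-1}\mathbb F_q[[t^{-1}]]$. For almost every $\alpha$, write its continued-fraction expansion as $\alpha=[0;A_1,A_2,\ldots]$, with convergents $P_j/Q_j$ normalized by $Q_0=1$, and put $s_0=0$ and $s_j=\deg Q_j=\sum_{k=1}^j\deg A_k$ for $j\ge1$. Then, for every $j\ge1$, $$L_1(n)=s_{j-1}+1\qquad\text{for all integers } n \text{ with } s_{j-1}\le n\le s_j-1.$$ Consequently $d^{(1)}_j=s_{j-1}+1$ for all $j\ge1$, and for every $n\ge0$ $$J^{(1)}_n=\mathbf 1_{\{n+1\in\{s_1,s_2,\ldots\}\}}.$$ The $j$th plateau of $L_1$ has length $s_j-s_{j-1}=\deg A_j$. Moreover, the partial quotients $A_1,A_2,\ldots$ are iid and $$\mathbb P(\deg A_j=h)=(q-1)q^{-h}=(1-q^{-1})q^{-(h-1)},\qquad h\ge1.$$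
   Context: $\mathfrak p=t^{-1}\mathbb F_q[[t^{-1}]]\subset\mathbb F_q((t^{-1}))$ carries its Haar probability measure. For $x=\sum_j a_jt^j\in\mathbb F_q((t^{-1}))$ the cancellation length $c(x)$ is the largest $n\ge0$ such that the coefficients of $t^{-1},\ldots,t^{-n}$ in $x$ all vanish ($c(x)=\infty$ if all negative coefficients vanish). For nonzero $Q\in\mathbb F_q[t]$, $d(Q)=\deg Q+1$, and $$L_1(n)=\min\{d(Q):0\ne Q\in\mathbb F_q[t],\ c(Q\alpha)\ge n\},\qquad n\ge0.$$ This is a nondecreasing function of $n$. $J^{(1)}_n=\mathbf 1_{\{L_1(n+1)>L_1(n)\}}$. $d^{(1)}_1<d^{(1)}_2<\cdots$ is the increasing list of distinct values of $L_1(n)$, $n\ge0$ (infinite for almost every $\alpha$). The $j$th plateau is the set of $n\ge0$ with $L_1(n)=d^{(1)}_j$, and its length is its cardinality. The continued fraction is the standard (Artin) one for Laurent series: the partial quotients $A_k\in\mathbb F_q[t]$ have positive degree, and the denominators of the convergents satisfy $Q_{-1}=0$, $Q_0=1$, $Q_j=A_jQ_{j-1}+Q_{j-2}$. The expansion is infinite exactly when $\alpha$ is not a rational function, which holds almost surely. *)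

theory Defs
  imports
    "HOL-Probability.Probability"
    "HOL-Computational_Algebra.Formal_Laurent_Series"
begin

text \<open>
  The field $\mathbb F_q((t^{-1}))$ is the type \<^typ>\<open>'a fls\<close> of formal Laurent series over a
  finite field in the variable \<^term>\<open>fls_X\<close>, read as $t^{-1}$. Thus the coefficient of $t^j$ in
  \<open>x\<close> is \<open>fls_nth x (- j)\<close>, the coefficient of $t^{-i}$ is \<open>fls_nth x i\<close>,
  and $t$ itself is \<^term>\<open>fls_X_inv\<close>.
\<close>

definition poly_to_fls :: "'a::field poly \<Rightarrow> 'a fls" where
  "poly_to_fls Q = poly (map_poly fls_const Q) fls_X_inv"

text \<open>The polynomial part of a series: its terms $a_j t^j$ with $j \ge 0$. The library's
  \<^const>\<open>fls_prpart\<close> collects only those with $j > 0$.\<close>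

definition poly_part :: "'a::field fls \<Rightarrow> 'a poly" where
  "poly_part x = fls_prpart x + [:fls_nth x 0:]"

definition frak_p :: "'a::field fls set" where
  "frak_p = {x. \<forall>i\<le>0. fls_nth x i = 0}"

text \<open>The topology on \<^typ>\<open>'a fls\<close> is the library's one, the \<open>fls_X\<close>-adic topology.
  Haar probability measure on the compact additive group \<^const>\<open>frak_p\<close> is the
  translation-invariant Borel probability measure; \<open>haar_prob_exists\<close> below shows that there is one.\<close>

definition haar_prob :: "'a::field fls measure \<Rightarrow> bool" where
  "haar_prob M \<longleftrightarrow>
     prob_space M \<and> space M = frak_p \<and> sets M = sets (restrict_space borel frak_p) \<and>
     (\<forall>a\<in>frak_p. \<forall>B\<in>sets M. emeasure M ((+) a ` B) = emeasure M B)"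

definition cancellation_length :: "'a::field fls \<Rightarrow> enat" where
  "cancellation_length x = Sup {enat n | n. \<forall>i\<in>{1..n}. fls_nth x (int i) = 0}"

definition L1 :: "'a::field fls \<Rightarrow> nat \<Rightarrow> nat" where
  "L1 \<alpha> n = (LEAST d. \<exists>Q. Q \<noteq> 0 \<and> cancellation_length (poly_to_fls Q * \<alpha>) \<ge> enat n \<and>
                          d = degree Q + 1)"

definition J1 :: "'a::field fls \<Rightarrow> nat \<Rightarrow> nat" where
  "J1 \<alpha> n = of_bool (L1 \<alpha> (n + 1) > L1 \<alpha> n)"

text \<open>\<open>d1 \<alpha> j\<close> is the \<open>j\<close>th smallest value of \<^term>\<open>L1 \<alpha>\<close> for \<open>j \<ge> 1\<close>;
  \<^const>\<open>enumerate\<close> counts from 0 and is meaningful when the set of values is infinite.\<close>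

definition d1 :: "'a::field fls \<Rightarrow> nat \<Rightarrow> nat" where
  "d1 \<alpha> j = enumerate (range (L1 \<alpha>)) (j - 1)"

definition plateau :: "'a::field fls \<Rightarrow> nat \<Rightarrow> nat set" where
  "plateau \<alpha> j = {n. L1 \<alpha> n = d1 \<alpha> j}"

text \<open>Artin's algorithm: $\alpha_0 = \alpha$, $A_k$ is the polynomial part of $\alpha_k$, and
  $\alpha_{k+1} = 1/(\alpha_k - A_k)$. If the expansion terminates, the division \<open>1 / 0 = 0\<close>
  makes all further $\alpha_k$ and $A_k$ zero.\<close>

primrec complete_quotient :: "'a::field fls \<Rightarrow> nat \<Rightarrow> 'a fls" where
  "complete_quotient \<alpha> 0 = \<alpha>"
| "complete_quotient \<alpha> (Suc k) =
     1 / (complete_quotient \<alpha> k - poly_to_fls (poly_part (complete_quotient \<alpha> k)))"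

definition partial_quotient :: "'a::field fls \<Rightarrow> nat \<Rightarrow> 'a poly" where
  "partial_quotient \<alpha> k = poly_part (complete_quotient \<alpha> k)"

text \<open>Numerators and denominators of the convergents of $[A_0; A_1, A_2, \ldots]$, with the
  initial values $P_{-1} = 1$ and $Q_{-1} = 0$ absorbed into the clauses for index 1.\<close>

fun cf_num :: "(nat \<Rightarrow> 'a::field poly) \<Rightarrow> nat \<Rightarrow> 'a poly" where
  "cf_num A 0 = A 0"
| "cf_num A (Suc 0) = A 1 * A 0 + 1"
| "cf_num A (Suc (Suc j)) = A (Suc (Suc j)) * cf_num A (Suc j) + cf_num A j"

fun cf_den :: "(nat \<Rightarrow> 'a::field poly) \<Rightarrow> nat \<Rightarrow> 'a poly" where
  "cf_den A 0 = 1"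
| "cf_den A (Suc 0) = A 1"
| "cf_den A (Suc (Suc j)) = A (Suc (Suc j)) * cf_den A (Suc j) + cf_den A j"

text \<open>The equation $\alpha = [A_0; A_1, A_2, \ldots]$ with an infinite right-hand side.\<close>

definition is_cf_expansion :: "(nat \<Rightarrow> 'a::field poly) \<Rightarrow> 'a fls \<Rightarrow> bool" where
  "is_cf_expansion A \<alpha> \<longleftrightarrow>
     (\<forall>j\<ge>1. degree (A j) > 0) \<and>
     (\<lambda>j. poly_to_fls (cf_num A j) / poly_to_fls (cf_den A j)) \<longlonglongrightarrow> \<alpha>"

definition cf_deg :: "'a::field fls \<Rightarrow> nat \<Rightarrow> nat" where
  "cf_deg \<alpha> j = degree (cf_den (partial_quotient \<alpha>) j)"

definition frak_p_of_seq :: "(nat \<Rightarrow> 'a::field) \<Rightarrow> 'a fls" where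
  "frak_p_of_seq w = fls_shift (-1) (fps_to_fls (Abs_fps w))"

lemma nth_frak_p_of_seq:
  "fls_nth (frak_p_of_seq w) i = (if i \<le> 0 then 0 else w (nat (i - 1)))"
  by (auto simp: frak_p_of_seq_def)

lemma frak_p_of_seq_in: "frak_p_of_seq w \<in> frak_p"
  by (auto simp: frak_p_def nth_frak_p_of_seq)

lemma frak_p_of_seq_add:
  "frak_p_of_seq v + frak_p_of_seq w = frak_p_of_seq (\<lambda>i. v i + w i)"
  by (auto simp: fls_eq_iff nth_frak_p_of_seq)

lemma frak_p_of_seq_surj:
  assumes "a \<in> frak_p" shows "frak_p_of_seq (\<lambda>i. fls_nth a (int i + 1)) = a"
  using assms by (auto simp: fls_eq_iff nth_frak_p_of_seq frak_p_def)

lemma dist_frak_p_of_seq_lt: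
  assumes "\<And>i. i < n \<Longrightarrow> v i = w i" "e > 0" "inverse (2 ^ n) < e"
  shows "dist (frak_p_of_seq v) (frak_p_of_seq w) < e"
proof (cases "frak_p_of_seq v = frak_p_of_seq w")
  case False
  let ?d = "frak_p_of_seq v - frak_p_of_seq w"
  have nz: "?d \<noteq> 0" using False by simp
  have "int n \<le> fls_subdegree ?d"
  proof (rule fls_subdegree_geI[OF nz])
    fix k assume "k < int n"
    then show "fls_nth ?d k = 0" by (auto simp: nth_frak_p_of_seq intro!: assms(1))
  qed
  moreover from this have "dist (frak_p_of_seq v) (frak_p_of_seq w) = inverse (2 ^ nat (fls_subdegree ?d))"
    using False by (simp add: dist_fls_def)
  moreover have "(2::real) ^ n \<le> 2 ^ nat (fls_subdegree ?d)"
    using calculation(1) by (intro power_increasing) auto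
  ultimately have "dist (frak_p_of_seq v) (frak_p_of_seq w) \<le> inverse (2 ^ n)"
    by (simp add: le_imp_inverse_le)
  then show ?thesis using assms(3) by linarith
qed (use assms in auto)

lemma haar_prob_exists: "\<exists>M :: 'a::{field,finite} fls measure. haar_prob M"
proof -
  let ?U = "\<lambda>_::nat. uniform_count_measure (UNIV :: 'a set)"
  let ?P = "PiM UNIV ?U"
  let ?R = "restrict_space borel (frak_p :: 'a fls set)"
  let ?f = "frak_p_of_seq :: (nat \<Rightarrow> 'a) \<Rightarrow> 'a fls"
  have pU: "prob_space (uniform_count_measure (UNIV :: 'a set))"
    by (intro prob_space_uniform_count_measure) auto
  interpret product_prob_space ?U UNIV
    using pU by unfold_locales (auto simp: prob_space_def prob_space_axioms_def
        finite_measure_def intro: prob_space_imp_sigma_finite pU)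
  have sp: "space ?P = UNIV" by (simp add: space_PiM space_uniform_count_measure PiE_UNIV_domain)
  have comp: "(\<lambda>w. w i) \<in> measurable ?P (uniform_count_measure UNIV)" for i
    by (rule measurable_component_singleton) simp
  have cyl: "{w. \<forall>i<n. w i = x i} \<in> sets ?P" for n and x :: "nat \<Rightarrow> 'a"
  proof -
    have "(\<lambda>w. w i) -` {x i} \<inter> space ?P \<in> sets ?P" for i
      by (rule measurable_sets[OF comp]) (simp add: sets_uniform_count_measure)
    then have "(\<Inter>i\<in>{..<n}. (\<lambda>w. w i) -` {x i} \<inter> space ?P) \<inter> space ?P \<in> sets ?P"
      by (cases "n = 0") (auto intro!: sets.finite_INT sets.Int)
    also have "(\<Inter>i\<in>{..<n}. (\<lambda>w. w i) -` {x i} \<inter> space ?P) \<inter> space ?P = {w. \<forall>i<n. w i = x i}"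
      by (auto simp: sp)
    finally show ?thesis .
  qed
  have openm: "?f -` V \<in> sets ?P" if "open V" for V
  proof -
    define C where "C = (\<lambda>xs::'a list. {w::nat \<Rightarrow> 'a. \<forall>i<length xs. w i = xs ! i})"
    have "?f -` V = (\<Union>xs\<in>{xs. C xs \<subseteq> ?f -` V}. C xs)"
    proof (intro equalityI subsetI)
      fix w assume w: "w \<in> ?f -` V"
      then have "?f w \<in> V" by simp
      with that have "\<exists>e>0. \<forall>y. dist y (?f w) < e \<longrightarrow> y \<in> V"
        unfolding open_dist by (rule bspec)
      then obtain e where e: "e > 0" "\<And>y. dist y (?f w) < e \<Longrightarrow> y \<in> V"
        by (elim exE conjE) simp
      obtain n where n: "inverse (2 ^ n) < e"
        using real_arch_pow_inv[OF e(1), of "1/2"] by (auto simp: power_one_over inverse_eq_divide)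
      have "C (map w [0..<n]) \<subseteq> ?f -` V"
      proof
        fix v assume "v \<in> C (map w [0..<n])"
        then have "\<And>i. i < n \<Longrightarrow> v i = w i" by (simp add: C_def)
        then have "dist (?f v) (?f w) < e" by (rule dist_frak_p_of_seq_lt[OF _ e(1) n])
        then show "v \<in> ?f -` V" by (simp add: e(2))
      qed
      moreover have "w \<in> C (map w [0..<n])" by (auto simp: C_def)
      ultimately show "w \<in> (\<Union>xs\<in>{xs. C xs \<subseteq> ?f -` V}. C xs)" by blast
    qed auto
    also have "\<dots> \<in> sets ?P"
    proof (rule sets.countable_UN'')
      show "C xs \<in> sets ?P" for xs
        unfolding C_def by (rule cyl)
    qed simp
    finally show ?thesis .
  qed
  have fm: "?f \<in> measurable ?P ?R"
  proof (rule measurable_restrict_space2)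
    show "?f \<in> borel_measurable ?P"
      by (rule borel_measurableI) (use openm sp in auto)
  qed (auto simp: frak_p_of_seq_in)
  let ?M = "distr ?P ?R ?f"
  have tr: "distr ?P ?P (\<lambda>w i. b i + w i) = ?P" for b :: "nat \<Rightarrow> 'a"
  proof (rule PiM_eq)
    have mm: "(\<lambda>w i. b i + w i) \<in> measurable ?P ?P"
    proof (rule measurable_PiM_single')
      fix i
      have "(\<lambda>x. b i + x) \<in> measurable (uniform_count_measure UNIV) (uniform_count_measure (UNIV::'a set))"
        by (simp add: measurable_def space_uniform_count_measure sets_uniform_count_measure)
      from measurable_compose[OF comp this]
      show "(\<lambda>w. b i + w i) \<in> measurable ?P (uniform_count_measure UNIV)" .
    qed (auto simp: space_uniform_count_measure)
    fix J :: "nat set" and E :: "nat \<Rightarrow> 'a set"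
    assume J: "finite J" "J \<subseteq> UNIV" "\<And>i. i \<in> J \<Longrightarrow> E i \<in> sets (uniform_count_measure UNIV)"
    have *: "emeasure ?P (prod_emb UNIV ?U J (Pi\<^sub>E J F)) = (\<Prod>i\<in>J. emeasure (?U i) (F i))" for F
      by (rule emeasure_PiM_emb) (use J in \<open>auto simp: sets_uniform_count_measure\<close>)
    have "(\<lambda>w i. b i + w i) -` prod_emb UNIV ?U J (Pi\<^sub>E J E) \<inter> space ?P
        = prod_emb UNIV ?U J (Pi\<^sub>E J (\<lambda>i. (\<lambda>x. b i + x) -` E i))"
      by (auto simp: prod_emb_def space_PiM space_uniform_count_measure PiE_iff)
    moreover have "prod_emb UNIV ?U J (Pi\<^sub>E J E) \<in> sets ?P"
      by (rule sets_PiM_I) (use J in auto)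
    ultimately have "emeasure (distr ?P ?P (\<lambda>w i. b i + w i)) (prod_emb UNIV ?U J (Pi\<^sub>E J E))
        = (\<Prod>i\<in>J. emeasure (?U i) ((\<lambda>x. b i + x) -` E i))"
      using mm * by (simp add: emeasure_distr)
    also have "\<dots> = (\<Prod>i\<in>J. emeasure (?U i) (E i))"
    proof (rule prod.cong[OF refl])
      fix i
      have "card ((\<lambda>x. b i + x) -` E i) = card (E i)"
      proof (rule card_vimage_inj)
        show "E i \<subseteq> range ((+) (b i))" by (metis subset_UNIV surj_plus)
      qed simp
      then show "emeasure (?U i) ((\<lambda>x. b i + x) -` E i) = emeasure (?U i) (E i)"
        by (simp add: emeasure_uniform_count_measure)
    qed
    finally show "emeasure (distr ?P ?P (\<lambda>w i. b i + w i)) (prod_emb UNIV ?U J (Pi\<^sub>E J E))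
        = (\<Prod>i\<in>J. emeasure (?U i) (E i))" .
  qed simp
  have "haar_prob ?M"
    unfolding haar_prob_def
  proof (intro conjI ballI)
    show "prob_space ?M" by (rule prob_space_distr[OF fm])
    show "space ?M = frak_p" by (simp add: space_restrict_space)
    show "sets ?M = sets ?R" by simp
    fix a :: "'a fls" and B assume a: "a \<in> frak_p" and B: "B \<in> sets ?M"
    define b where "b = (\<lambda>i. fls_nth a (int i + 1))"
    have ab: "?f b = a" unfolding b_def by (rule frak_p_of_seq_surj[OF a])
    have Bs: "B \<subseteq> frak_p" using B sets.sets_into_space[of B ?R] by (auto simp: space_restrict_space)
    have nm: "(\<lambda>w i. - b i + w i) \<in> measurable ?P ?P"
    proof (rule measurable_PiM_single')
      fix i
      have "(\<lambda>x. - b i + x) \<in> measurable (uniform_count_measure UNIV) (uniform_count_measure (UNIV::'a set))"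
        by (simp add: measurable_def space_uniform_count_measure sets_uniform_count_measure)
      from measurable_compose[OF comp this]
      show "(\<lambda>w. - b i + w i) \<in> measurable ?P (uniform_count_measure UNIV)" .
    qed (auto simp: space_uniform_count_measure)
    have eq: "?f -` ((+) a ` B) = (\<lambda>w i. - b i + w i) -` (?f -` B)"
    proof (intro equalityI subsetI)
      fix w assume "w \<in> ?f -` ((+) a ` B)"
      then obtain y where y: "y \<in> B" "?f w = ?f b + y" using ab by auto
      have "?f b + ?f (\<lambda>i. - b i + w i) = ?f w" by (simp add: frak_p_of_seq_add)
      then show "w \<in> (\<lambda>w i. - b i + w i) -` (?f -` B)" using y by auto
    next
      fix w assume "w \<in> (\<lambda>w i. - b i + w i) -` (?f -` B)"
      moreover have "?f w = a + ?f (\<lambda>i. - b i + w i)"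
        unfolding ab[symmetric] by (simp add: frak_p_of_seq_add)
      ultimately show "w \<in> ?f -` ((+) a ` B)" by auto
    qed
    have nmR: "(\<lambda>x. - a + x) \<in> measurable ?R ?R"
    proof (rule measurable_restrict_space3)
      have "continuous_on UNIV (\<lambda>x. - a + x)"
        unfolding continuous_on_iff by (auto simp: dist_fls_def)
      then show "(\<lambda>x. - a + x) \<in> borel_measurable borel"
        by (rule borel_measurable_continuous_onI)
    qed (use a in \<open>auto simp: frak_p_def\<close>)
    have "(\<lambda>x. - a + x) -` B \<inter> space ?R \<in> sets ?R"
      by (rule measurable_sets[OF nmR]) (use B in simp)
    also have "(\<lambda>x. - a + x) -` B \<inter> space ?R = (+) a ` B"
    proof (intro equalityI subsetI)
      fix x assume "x \<in> (\<lambda>x. - a + x) -` B \<inter> space ?R"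
      then have "- a + x \<in> B" by auto
      then show "x \<in> (+) a ` B" by (intro image_eqI[of _ _ "- a + x"]) auto
    qed (use a Bs in \<open>auto simp: space_restrict_space frak_p_def\<close>)
    finally have "emeasure ?M ((+) a ` B) = emeasure ?P (?f -` ((+) a ` B))"
      using fm sp by (simp add: emeasure_distr)
    also have "\<dots> = emeasure (distr ?P ?P (\<lambda>w i. - b i + w i)) (?f -` B)"
      unfolding eq using nm measurable_sets[OF fm, of B] B sp by (simp add: emeasure_distr)
    also have "\<dots> = emeasure ?P (?f -` B)" by (simp only: tr)
    also have "\<dots> = emeasure ?M B"
      using fm B sp by (simp add: emeasure_distr)
    finally show "emeasure ?M ((+) a ` B) = emeasure ?M B" .
  qed
  then show ?thesis by blast
qed

end

theory Submission
  imports Defs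
begin

text \<open>
  Write \<open>\<epsilon>\<^sub>k\<close> for the fractional part of the \<open>k\<close>th complete quotient, so that the next complete
  quotient is \<open>1 / \<epsilon>\<^sub>k\<close> and \<open>\<epsilon>\<^sub>k\<close> has order \<open>deg A\<^sub>k\<^sub>+\<^sub>1\<close> in \<open>1/t\<close>. As long as the expansion does
  not terminate, the error \<open>Q\<^sub>k \<alpha> - P\<^sub>k\<close> of the \<open>k\<close>th convergent is
  \<open>\<plusminus> \<epsilon>\<^sub>0 \<epsilon>\<^sub>1 \<dots> \<epsilon>\<^sub>k\<close> (lemma \<open>remainder_eq\<close>), hence has order exactly \<open>s\<^sub>k\<^sub>+\<^sub>1\<close>. Thus \<open>Q\<^sub>k \<alpha>\<close> has
  cancellation length at least \<open>s\<^sub>k\<^sub>+\<^sub>1 - 1\<close>, at the cost \<open>d(Q\<^sub>k) = s\<^sub>k + 1\<close>. No nonzero \<open>R\<close> of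
  degree below \<open>s\<^sub>k\<close> makes the cancellation length of \<open>R \<alpha>\<close> reach \<open>s\<^sub>k\<close>: the cross product of its approximation with a
  convergent is a polynomial all of whose terms are negative powers of \<open>t\<close>, hence zero, and
  comparing orders starts a descent along the convergents (lemma \<open>no_better_approximation\<close>). So
  \<open>L\<^sub>1\<close> is constant on each \<open>[s\<^sub>k, s\<^sub>k\<^sub>+\<^sub>1)\<close> with value \<open>s\<^sub>k + 1\<close>, which gives all assertions about
  plateaus and jumps.

  For the law, a branch \<open>y \<mapsto> 1 / (a + y)\<close> of the inverse Gauss map with \<open>deg a > 0\<close> multiplies
  differences by an element of order exactly \<open>2 deg a\<close>, so it maps the ball of level \<open>n\<close> onto the ball
  of level \<open>n + 2 deg a\<close> (lemma \<open>gauss_map_branch\<close>). By induction, prescribing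
  \<open>A\<^sub>1, \<dots>, A\<^sub>k\<close> to be given polynomials of positive degree confines \<open>\<alpha>\<close> to a ball of level
  \<open>2 \<Sum> deg A\<^sub>i\<close>, whose Haar measure \<open>q\<^bsup>-2 \<Sum> deg A\<^sub>i\<^esup>\<close> is a product over the coordinates. The
  joint law of the first \<open>k\<close> partial quotients therefore agrees with the \<open>k\<close>-fold product of the law
  of \<open>A\<^sub>1\<close> on all points with coordinates of positive degree, and the product gives mass zero to all
  other points, because \<open>A\<^sub>1\<close> is constant only at the null point \<open>\<alpha> = 0\<close>. So the product law is dominated
  pointwise by the joint law; both are probability measures on a countable set, hence they are equal
  (lemma \<open>joint_law\<close>). Independence, identical distribution and the almost sure absence of
  termination all follow. Finally \<open>deg A\<^sub>1\<close> is the order of \<open>\<alpha>\<close>, so \<open>deg A\<^sub>1 = h\<close> describes the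
  difference of the balls around \<open>0\<close> of levels \<open>h - 1\<close> and \<open>h\<close>.
\<close>

section \<open>Polynomials as Laurent series\<close>

lemma nth_poly_to_fls: "fls_nth (poly_to_fls Q) i = (if i \<le> 0 then coeff Q (nat (- i)) else 0)"
proof (induction Q arbitrary: i rule: pCons_induct)
  case 0
  then show ?case by (simp add: poly_to_fls_def)
next
  case (pCons a Q)
  have "poly_to_fls (pCons a Q) = fls_const a + fls_X_inv * poly_to_fls Q"
    using pCons(1) by (simp add: poly_to_fls_def map_poly_pCons)
  then show ?case using pCons(2)
    by (auto simp: fls_X_inv_times_conv_shift nat_diff_distrib coeff_pCons split: nat.splits)
qed

lemma poly_to_fls_eq_iff: "poly_to_fls P = poly_to_fls Q \<longleftrightarrow> P = Q"
proof
  assume eq: "poly_to_fls P = poly_to_fls Q"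
  have "coeff P n = coeff Q n" for n
    using arg_cong[OF eq, of "\<lambda>x. fls_nth x (- int n)"] by (simp add: nth_poly_to_fls)
  then show "P = Q" by (rule poly_eqI)
qed simp

lemma poly_to_fls_0 [simp]: "poly_to_fls 0 = 0"
  and poly_to_fls_1 [simp]: "poly_to_fls 1 = 1"
  and poly_to_fls_add: "poly_to_fls (P + Q) = poly_to_fls P + poly_to_fls Q"
  and poly_to_fls_diff: "poly_to_fls (P - Q) = poly_to_fls P - poly_to_fls Q"
  by (auto simp: fls_eq_iff nth_poly_to_fls coeff_1)

lemma poly_to_fls_eq_0_iff [simp]: "poly_to_fls Q = 0 \<longleftrightarrow> Q = 0"
  using poly_to_fls_eq_iff[of Q 0] by simp

lemma poly_to_fls_mult: "poly_to_fls (P * Q) = poly_to_fls P * poly_to_fls Q"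
proof (induction P rule: pCons_induct)
  case (pCons a P)
  have s: "poly_to_fls (smult a Q) = fls_const a * poly_to_fls Q"
    by (auto simp: fls_eq_iff nth_poly_to_fls)
  have c: "poly_to_fls (pCons b R) = fls_const b + fls_X_inv * poly_to_fls R" for b :: 'a and R
    by (cases "b = 0 \<and> R = 0") (auto simp: poly_to_fls_def map_poly_pCons)
  show ?case
    by (simp add: poly_to_fls_add s c pCons.IH algebra_simps)
qed simp

lemma subdegree_poly_to_fls: "fls_subdegree (poly_to_fls Q) = - int (degree Q)"
proof (cases "Q = 0")
  case False
  show ?thesis
  proof (rule fls_subdegree_eqI)
    show "fls_nth (poly_to_fls Q) (- int (degree Q)) \<noteq> 0"
      using False by (simp add: nth_poly_to_fls)
  qed (auto simp: nth_poly_to_fls intro: coeff_eq_0)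
qed simp

lemma coeff_poly_part: "coeff (poly_part x) n = fls_nth x (- int n)"
  by (cases n) (auto simp: poly_part_def)

section \<open>The filtration by order\<close>

text \<open>The condition is on coefficients so that \<open>0\<close> satisfies it for every \<open>n\<close>, as in the
  convention that \<open>0\<close> has infinite order; \<^const>\<open>fls_subdegree\<close> assigns \<open>0\<close> to it.\<close>

definition order_ge :: "int \<Rightarrow> 'a::field fls \<Rightarrow> bool" where
  "order_ge n x \<longleftrightarrow> (\<forall>i<n. fls_nth x i = 0)"

lemma order_ge_iff: "order_ge n x \<longleftrightarrow> x = 0 \<or> n \<le> fls_subdegree x"
proof
  assume "order_ge n x"
  then show "x = 0 \<or> n \<le> fls_subdegree x"
    unfolding order_ge_def using fls_subdegree_geI by blast
qed (auto simp: order_ge_def)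

lemma frak_p_iff: "x \<in> frak_p \<longleftrightarrow> order_ge 1 x"
  by (auto simp: frak_p_def order_ge_def)

lemma order_ge_add: "order_ge n x \<Longrightarrow> order_ge n y \<Longrightarrow> order_ge n (x + y)"
  and order_ge_diff: "order_ge n x \<Longrightarrow> order_ge n y \<Longrightarrow> order_ge n (x - y)"
  and order_ge_mono: "order_ge n x \<Longrightarrow> m \<le> n \<Longrightarrow> order_ge m x"
  by (auto simp: order_ge_def)

lemma order_ge_minus_commute: "order_ge n (x - y) \<longleftrightarrow> order_ge n (y - x)"
  by (auto simp: order_ge_def)

lemma order_ge_mult: "order_ge m x \<Longrightarrow> order_ge n y \<Longrightarrow> order_ge (m + n) (x * y)"
  by (cases "x = 0"; cases "y = 0") (auto simp: order_ge_iff)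

lemma subdegree_divide:
  fixes x y :: "'a::field fls"
  assumes "x \<noteq> 0" "y \<noteq> 0" shows "fls_subdegree (x / y) = fls_subdegree x - fls_subdegree y"
proof -
  have "fls_subdegree (x / y * y) = fls_subdegree (x / y) + fls_subdegree y"
    using assms by (intro fls_subdegree_mult) auto
  then show ?thesis using assms by simp
qed

lemma order_ge_divide: "order_ge n x \<Longrightarrow> order_ge (n - fls_subdegree y) (x / y)"
  by (cases "x = 0"; cases "y = 0") (auto simp: order_ge_iff subdegree_divide)

lemma order_ge_poly_to_fls: "- int (degree Q) \<ge> n \<Longrightarrow> order_ge n (poly_to_fls Q)"
  by (simp add: order_ge_iff subdegree_poly_to_fls)

text \<open>A nonzero polynomial in \<open>t\<close> has order at most \<open>0\<close>, so a series splits in only one way into a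
  polynomial and a series in negative powers of \<open>t\<close>.\<close>

lemma poly_part_unique: "order_ge 1 (x - poly_to_fls Q) \<longleftrightarrow> poly_part x = Q"
proof
  assume *: "order_ge 1 (x - poly_to_fls Q)"
  show "poly_part x = Q"
  proof (rule poly_eqI)
    fix n show "coeff (poly_part x) n = coeff Q n"
      using *[unfolded order_ge_def, rule_format, of "- int n"]
      by (simp add: coeff_poly_part nth_poly_to_fls)
  qed
qed (auto simp: order_ge_def nth_poly_to_fls coeff_poly_part)

lemma order_ge_frac_part: "order_ge 1 (x - poly_to_fls (poly_part x))"
  by (simp add: poly_part_unique)

lemma poly_part_frak_p: "x \<in> frak_p \<Longrightarrow> poly_part x = 0"
  by (rule poly_part_unique[THEN iffD1]) (simp add: frak_p_iff)

lemma poly_order_ge_1_imp_0: "order_ge 1 (poly_to_fls Q) \<Longrightarrow> Q = 0"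
  by (auto simp: order_ge_iff subdegree_poly_to_fls)

lemma subdegree_via_poly_part:
  assumes "degree (poly_part x) > 0"
  shows "fls_subdegree x = - int (degree (poly_part x))"
proof (rule fls_subdegree_eqI)
  show "fls_nth x (- int (degree (poly_part x))) \<noteq> 0"
    using assms coeff_poly_part[of x "degree (poly_part x)"] leading_coeff_0_iff[of "poly_part x"]
    by (metis degree_0 less_irrefl)
next
  fix k assume k: "k < - int (degree (poly_part x))"
  then have "coeff (poly_part x) (nat (- k)) = 0" by (intro coeff_eq_0) auto
  then show "fls_nth x k = 0" using k by (simp add: coeff_poly_part)
qed

lemma degree_poly_part_neg_subdegree:
  assumes "fls_subdegree x \<le> 0"
  shows "int (degree (poly_part x)) = - fls_subdegree x"
proof (cases "fls_subdegree x = 0")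
  case True
  have "poly_part x = [:fls_nth x 0:]"
    using True by (auto simp: poly_eq_iff coeff_poly_part coeff_pCons split: nat.splits)
  then show ?thesis using True by simp
next
  case False
  then have "x \<noteq> 0" by auto
  with assms False have "coeff (poly_part x) (nat (- fls_subdegree x)) \<noteq> 0"
    by (simp add: coeff_poly_part)
  then have "degree (poly_part x) \<ge> nat (- fls_subdegree x)" by (rule le_degree)
  with False assms subdegree_via_poly_part[of x] show ?thesis by auto
qed

section \<open>Convergents\<close>

definition frac_part :: "'a::field fls \<Rightarrow> 'a fls" where
  "frac_part x = x - poly_to_fls (poly_part x)"

lemma frac_part_in_frak_p: "frac_part x \<in> frak_p"
  by (simp add: frak_p_iff frac_part_def order_ge_frac_part)

lemma frac_part_frak_p: "x \<in> frak_p \<Longrightarrow> frac_part x = x"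
  by (simp add: frac_part_def poly_part_frak_p)

lemma poly_part_0 [simp]: "poly_part 0 = 0"
  by (simp add: poly_part_def)

lemma frac_part_0: "frac_part 0 = 0"
  by (simp add: frac_part_def)

lemma complete_quotient_Suc: "complete_quotient \<alpha> (Suc k) = 1 / frac_part (complete_quotient \<alpha> k)"
  by (simp add: frac_part_def)

text \<open>In terms of \<^const>\<open>frac_part\<close> the recursion keeps its shape under simplification; the defining
  equation would expose the subtraction of the polynomial part.\<close>

declare complete_quotient.simps(2) [simp del]

lemma complete_quotient_eq:
  "complete_quotient \<alpha> k = poly_to_fls (partial_quotient \<alpha> k) + frac_part (complete_quotient \<alpha> k)"
  by (simp add: frac_part_def partial_quotient_def)

text \<open>After termination all partial quotients vanish, so positive degree of every \<open>A\<^sub>k\<close> with \<open>k \<ge> 1\<close>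
  says that the expansion is infinite.\<close>

locale infinite_cf =
  fixes \<alpha> :: "'a::field fls"
  assumes in_frak_p: "\<alpha> \<in> frak_p"
    and degree_pos: "\<And>k. k \<ge> 1 \<Longrightarrow> degree (partial_quotient \<alpha> k) > 0"
begin

abbreviation A :: "nat \<Rightarrow> 'a poly" where "A \<equiv> partial_quotient \<alpha>"
abbreviation P :: "nat \<Rightarrow> 'a poly" where "P \<equiv> cf_num A"
abbreviation Q :: "nat \<Rightarrow> 'a poly" where "Q \<equiv> cf_den A"
abbreviation s :: "nat \<Rightarrow> nat" where "s \<equiv> cf_deg \<alpha>"

definition \<epsilon> :: "nat \<Rightarrow> 'a fls" where "\<epsilon> k = frac_part (complete_quotient \<alpha> k)"
definition remainder :: "nat \<Rightarrow> 'a fls" where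
  "remainder k = poly_to_fls (Q k) * \<alpha> - poly_to_fls (P k)"

lemma A_0: "A 0 = 0"
  by (simp add: partial_quotient_def poly_part_frak_p in_frak_p)

lemma eps_nonzero: "\<epsilon> k \<noteq> 0"
proof
  assume "\<epsilon> k = 0"
  then have "partial_quotient \<alpha> (Suc k) = 0"
    by (simp add: \<epsilon>_def partial_quotient_def complete_quotient_Suc poly_part_frak_p frak_p_iff order_ge_def)
  then show False using degree_pos[of "Suc k"] by simp
qed

lemma inverse_eps: "1 / \<epsilon> k = poly_to_fls (A (Suc k)) + \<epsilon> (Suc k)"
  using complete_quotient_eq[of \<alpha> "Suc k"] by (simp add: \<epsilon>_def complete_quotient_Suc)

lemma subdegree_eps: "fls_subdegree (\<epsilon> k) = degree (A (Suc k))"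
proof -
  have "fls_subdegree (1 / \<epsilon> k) = - int (degree (A (Suc k)))"
    using subdegree_via_poly_part[of "complete_quotient \<alpha> (Suc k)"] degree_pos[of "Suc k"]
    by (simp add: \<epsilon>_def partial_quotient_def complete_quotient_Suc)
  then show ?thesis using subdegree_divide[of 1 "\<epsilon> k"] eps_nonzero[of k] by simp
qed

text \<open>Numerators and denominators obey the same recursion, hence so does the error:
  \<open>E\<^sub>k\<^sub>+\<^sub>2 = A\<^sub>k\<^sub>+\<^sub>2 E\<^sub>k\<^sub>+\<^sub>1 + E\<^sub>k\<close>. The factorisation propagates because
  \<open>1 / \<epsilon>\<^sub>k\<^sub>+\<^sub>1 = A\<^sub>k\<^sub>+\<^sub>2 + \<epsilon>\<^sub>k\<^sub>+\<^sub>2\<close> turns \<open>1 - A\<^sub>k\<^sub>+\<^sub>2 \<epsilon>\<^sub>k\<^sub>+\<^sub>1\<close> into \<open>\<epsilon>\<^sub>k\<^sub>+\<^sub>1 \<epsilon>\<^sub>k\<^sub>+\<^sub>2\<close>.\<close>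

lemma remainder_eq: "remainder k = (-1) ^ k * (\<Prod>i\<le>k. \<epsilon> i)"
proof (induction k rule: induct_nat_012)
  case 0
  have "\<epsilon> 0 = \<alpha>"
    using A_0 by (simp add: \<epsilon>_def frac_part_def partial_quotient_def)
  then show ?case by (simp add: remainder_def A_0)
next
  case 1
  have a: "\<epsilon> 0 = \<alpha>"
    using A_0 by (simp add: \<epsilon>_def frac_part_def partial_quotient_def)
  have "poly_to_fls (A 1) * \<epsilon> 0 - 1 = - (\<epsilon> 0 * \<epsilon> 1)"
    using inverse_eps[of 0] eps_nonzero[of 0] by (simp add: field_simps)
  then show ?case by (simp add: remainder_def A_0 a)
next
  case (ge2 k)
  let ?p = "\<Prod>i\<le>k. \<epsilon> i"
  have e: "1 - poly_to_fls (A (Suc (Suc k))) * \<epsilon> (Suc k) = \<epsilon> (Suc k) * \<epsilon> (Suc (Suc k))"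
    using inverse_eps[of "Suc k"] eps_nonzero[of "Suc k"] by (simp add: field_simps)
  have "remainder (Suc (Suc k)) = poly_to_fls (A (Suc (Suc k))) * remainder (Suc k) + remainder k"
    by (simp add: remainder_def poly_to_fls_add poly_to_fls_mult algebra_simps)
  also have "\<dots> = (-1) ^ k * ?p * (1 - poly_to_fls (A (Suc (Suc k))) * \<epsilon> (Suc k))"
    by (simp add: ge2 algebra_simps)
  finally show ?case by (simp only: e) (simp add: algebra_simps)
qed

text \<open>Nonvanishing and the degree formula are proved together: the leading term of
  \<open>A\<^sub>k\<^sub>+\<^sub>2 Q\<^sub>k\<^sub>+\<^sub>1\<close> survives the addition of \<open>Q\<^sub>k\<close> because the degrees of the denominators have grown
  strictly so far.\<close>

lemma degree_Q_aux: "Q k \<noteq> 0 \<and> degree (Q (Suc k)) = degree (A (Suc k)) + degree (Q k)"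
proof (induction k)
  case 0
  then show ?case by simp
next
  case (Suc k)
  have d: "degree (Q (Suc k)) > degree (Q k)" using Suc degree_pos[of "Suc k"] by simp
  then have nz: "Q (Suc k) \<noteq> 0" by auto
  have nzA: "A (Suc (Suc k)) \<noteq> 0" using degree_pos[of "Suc (Suc k)"] by auto
  have "degree (A (Suc (Suc k)) * Q (Suc k)) = degree (A (Suc (Suc k))) + degree (Q (Suc k))"
    using nz nzA by (rule degree_mult_eq[rotated])
  moreover have "degree (A (Suc (Suc k)) * Q (Suc k) + Q k) = degree (A (Suc (Suc k)) * Q (Suc k))"
    by (rule degree_add_eq_left) (use d calculation in simp)
  ultimately show ?case using nz by simp
qed

lemma Q_nonzero: "Q k \<noteq> 0"
  and s_0: "s 0 = 0"
  and s_Suc: "s (Suc k) = s k + degree (A (Suc k))"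
  and degree_Q: "degree (Q k) = s k"
  using degree_Q_aux[of k] by (auto simp: cf_deg_def)

lemma s_sum: "s j = (\<Sum>k=1..j. degree (A k))"
  by (induction j) (auto simp: s_0 s_Suc)

lemma strict_mono_s: "strict_mono s"
  using degree_pos by (intro strict_mono_Suc_iff[THEN iffD2]) (auto simp: s_Suc)

lemma remainder_nonzero: "remainder k \<noteq> 0"
  using eps_nonzero by (auto simp: remainder_eq)

lemma subdegree_remainder: "fls_subdegree (remainder k) = s (Suc k)"
proof -
  have "fls_subdegree (\<Prod>i\<le>k. \<epsilon> i) = s (Suc k)"
    by (induction k) (use eps_nonzero in \<open>auto simp: subdegree_eps s_Suc s_0\<close>)
  moreover have "fls_subdegree ((-1) ^ k * x) = fls_subdegree x" for x :: "'a fls"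
    by (induction k) auto
  ultimately show ?thesis by (simp add: remainder_eq)
qed

text \<open>The error divided by the denominator has order \<open>s\<^sub>j\<^sub>+\<^sub>1 + s\<^sub>j\<close>, which tends to infinity.\<close>

lemma convergents_tendsto:
  "(\<lambda>j. poly_to_fls (P j) / poly_to_fls (Q j)) \<longlonglongrightarrow> \<alpha>"
proof (rule metric_LIMSEQ_I)
  fix r :: real assume r: "0 < r"
  obtain N where N: "inverse (2 ^ N) < r"
    using real_arch_pow_inv[OF r, of "1/2"] by (auto simp: power_one_over inverse_eq_divide)
  have "dist (poly_to_fls (P j) / poly_to_fls (Q j)) \<alpha> < r" if j: "j \<ge> N" for j
  proof -
    let ?c = "poly_to_fls (P j) / poly_to_fls (Q j)"
    have "?c - \<alpha> = - remainder j / poly_to_fls (Q j)"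
      using Q_nonzero[of j] by (simp add: remainder_def field_simps)
    then have ne: "?c \<noteq> \<alpha>" and v: "fls_subdegree (?c - \<alpha>) = int (s (Suc j) + s j)"
      using remainder_nonzero[of j] Q_nonzero[of j]
        subdegree_divide[of "- remainder j" "poly_to_fls (Q j)"]
      by (auto simp: subdegree_remainder subdegree_poly_to_fls degree_Q)
    have "N \<le> s (Suc j) + s j"
      using strict_mono_imp_increasing[OF strict_mono_s, of j] j by simp
    then have "(2::real) ^ N \<le> 2 ^ (s (Suc j) + s j)" by (intro power_increasing) auto
    then have "inverse (2 ^ (s (Suc j) + s j)) \<le> inverse ((2::real) ^ N)"
      by (intro le_imp_inverse_le) auto
    then have "inverse ((2::real) ^ (s (Suc j) + s j)) < r" using N by linarith
    with ne v show ?thesis by (simp add: dist_fls_def del: of_nat_add)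
  qed
  then show "\<exists>N. \<forall>j\<ge>N. dist (poly_to_fls (P j) / poly_to_fls (Q j)) \<alpha> < r" by blast
qed

end

section \<open>Plateaus\<close>

lemma cancellation_length_ge_iff:
  "enat n \<le> cancellation_length x \<longleftrightarrow> (\<forall>i\<in>{1..n}. fls_nth x (int i) = 0)"
proof
  assume le: "enat n \<le> cancellation_length x"
  show "\<forall>i\<in>{1..n}. fls_nth x (int i) = 0"
  proof (cases n)
    case (Suc m)
    then have "enat m < cancellation_length x" using le Suc_ile_eq by blast
    then obtain k where "m < k" "\<forall>i\<in>{1..k}. fls_nth x (int i) = 0"
      unfolding cancellation_length_def less_Sup_iff by auto
    then show ?thesis using Suc by auto
  qed simp
qed (auto simp: cancellation_length_def intro: Sup_upper)

text \<open>Vanishing of the first \<open>n\<close> negative coefficients as closeness to a polynomial, the form in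
  which it can be combined with the convergents.\<close>

lemma cancellation_length_iff_order:
  "enat n \<le> cancellation_length x \<longleftrightarrow> order_ge (int n + 1) (x - poly_to_fls (poly_part x))"
proof -
  have "fls_nth (x - poly_to_fls (poly_part x)) i = (if i \<le> 0 then 0 else fls_nth x i)" for i
    by (simp add: nth_poly_to_fls coeff_poly_part)
  moreover have "(\<forall>i<int n + 1. (if i \<le> 0 then 0 else fls_nth x i) = 0) \<longleftrightarrow> (\<forall>i\<in>{1..n}. fls_nth x (int i) = 0)"
  proof safe
    fix i assume *: "\<forall>i<int n + 1. (if i \<le> 0 then 0 else fls_nth x i) = 0" "i \<in> {1..n}"
    then show "fls_nth x (int i) = 0" using *(1)[rule_format, of "int i"] by simp
  next
    fix i assume *: "\<forall>i\<in>{1..n}. fls_nth x (int i) = 0" "i < int n + 1"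
    then show "(if i \<le> 0 then 0 else fls_nth x i) = 0"
    proof (cases "i \<le> 0")
      case False
      then have "nat i \<in> {1..n}" "int (nat i) = i" using *(2) by auto
      then show ?thesis using *(1) False by metis
    qed simp
  qed
  ultimately show ?thesis by (simp add: cancellation_length_ge_iff order_ge_def)
qed

lemma enumerate_range_strict_mono:
  fixes f :: "nat \<Rightarrow> nat"
  assumes "strict_mono f" shows "enumerate (range f) n = f n"
proof (induction n)
  case 0
  show ?case unfolding enumerate_0
    by (rule Least_equality) (use assms in \<open>auto simp: strict_mono_less_eq\<close>)
next
  case (Suc n)
  have "infinite (range f)" using assms by (simp add: range_inj_infinite strict_mono_imp_inj_on)
  then show ?case
    by (subst enumerate_Suc'') (auto simp: Suc assms strict_mono_less strict_mono_less_eq intro!: Least_equality)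
qed

context infinite_cf
begin

text \<open>Descent along the convergents. Suppose that \<open>R \<alpha> - S\<close> has order above \<open>s\<^sub>k\<^sub>+\<^sub>1\<close> and
  \<open>deg R < s\<^sub>k\<^sub>+\<^sub>1\<close>. Both \<open>Q\<^sub>k (R \<alpha> - S)\<close> and \<open>R (Q\<^sub>k \<alpha> - P\<^sub>k)\<close> then have positive order, while their
  difference is the polynomial \<open>R P\<^sub>k - Q\<^sub>k S\<close>, so they coincide. Equality of their orders forces
  \<open>deg R < s\<^sub>k\<close>, which is the situation for the previous index; at index \<open>0\<close> it is absurd.\<close>

lemma no_better_approximation:
  assumes "R \<noteq> 0" "degree R < s k"
  shows "\<not> order_ge (int (s k) + 1) (poly_to_fls R * \<alpha> - poly_to_fls S)"
  using assms(2)
proof (induction k)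
  case 0
  then show ?case by (simp add: s_0)
next
  case (Suc k)
  let ?r = "poly_to_fls R * \<alpha> - poly_to_fls S"
  show ?case
  proof
    assume r: "order_ge (int (s (Suc k)) + 1) ?r"
    have eq: "poly_to_fls (Q k) * ?r - poly_to_fls R * remainder k = poly_to_fls (R * P k - Q k * S)"
      by (simp add: remainder_def poly_to_fls_mult poly_to_fls_diff algebra_simps)
    have "order_ge (- int (s k) + (int (s (Suc k)) + 1)) (poly_to_fls (Q k) * ?r)"
      by (rule order_ge_mult[OF _ r]) (simp add: order_ge_poly_to_fls degree_Q)
    then have 1: "order_ge 1 (poly_to_fls (Q k) * ?r)"
      by (rule order_ge_mono) (simp add: s_Suc)
    have "order_ge (- int (degree R) + int (s (Suc k))) (poly_to_fls R * remainder k)"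
      by (rule order_ge_mult) (simp_all add: order_ge_iff subdegree_remainder subdegree_poly_to_fls)
    then have "order_ge 1 (poly_to_fls R * remainder k)"
      by (rule order_ge_mono) (use Suc.prems in simp)
    with 1 have "order_ge 1 (poly_to_fls (R * P k - Q k * S))"
      using order_ge_diff eq by metis
    then have "poly_to_fls (Q k) * ?r = poly_to_fls R * remainder k"
      using poly_order_ge_1_imp_0 eq by fastforce
    moreover from this have rnz: "?r \<noteq> 0"
      using assms(1) remainder_nonzero[of k] by auto
    ultimately have "- int (s k) + fls_subdegree ?r = - int (degree R) + int (s (Suc k))"
      using fls_subdegree_mult[of "poly_to_fls (Q k)" ?r] fls_subdegree_mult[of "poly_to_fls R" "remainder k"]
        Q_nonzero[of k] assms(1) remainder_nonzero[of k]
      by (simp add: subdegree_poly_to_fls degree_Q subdegree_remainder)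
    moreover have "int (s (Suc k)) + 1 \<le> fls_subdegree ?r"
      using r rnz by (simp add: order_ge_iff)
    ultimately have "degree R < s k" by linarith
    with Suc.IH show False
      using order_ge_mono[OF r, of "int (s k) + 1"] by (simp add: s_Suc)
  qed
qed

text \<open>The minimum is attained by the denominator \<open>Q\<^sub>j\<close>.\<close>

lemma L1_eq:
  assumes "s j \<le> n" "n < s (Suc j)"
  shows "L1 \<alpha> n = s j + 1"
  unfolding L1_def
proof (rule Least_equality)
  have "poly_part (poly_to_fls (Q j) * \<alpha>) = P j"
    by (rule poly_part_unique[THEN iffD1], fold remainder_def)
      (use strict_mono_s[THEN strict_monoD, of 0 "Suc j"] in \<open>simp add: order_ge_iff subdegree_remainder s_0\<close>)
  then have "enat n \<le> cancellation_length (poly_to_fls (Q j) * \<alpha>)"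
    using assms(2) by (simp add: cancellation_length_iff_order remainder_def[symmetric] order_ge_iff subdegree_remainder)
  then show "\<exists>Q. Q \<noteq> 0 \<and> enat n \<le> cancellation_length (poly_to_fls Q * \<alpha>) \<and> s j + 1 = degree Q + 1"
    using Q_nonzero degree_Q by metis
next
  fix d assume "\<exists>Q. Q \<noteq> 0 \<and> enat n \<le> cancellation_length (poly_to_fls Q * \<alpha>) \<and> d = degree Q + 1"
  then obtain R where R: "R \<noteq> 0" "enat n \<le> cancellation_length (poly_to_fls R * \<alpha>)" "d = degree R + 1"
    by blast
  then have "order_ge (int (s j) + 1) (poly_to_fls R * \<alpha> - poly_to_fls (poly_part (poly_to_fls R * \<alpha>)))"
    using assms(1) order_ge_mono by (fastforce simp: cancellation_length_iff_order)
  then show "s j + 1 \<le> d"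
    using no_better_approximation[of R j] R by (meson add_le_mono1 not_le)
qed

lemma s_less_Suc: "s j < s (Suc j)"
  using strict_mono_s by (simp add: strict_mono_Suc_iff)

lemma ex_plateau: "\<exists>j. s j \<le> n \<and> n < s (Suc j)"
proof (induction n)
  case 0
  have "s 0 \<le> 0 \<and> 0 < s (Suc 0)" using s_less_Suc[of 0] s_0 by linarith
  then show ?case by blast
next
  case (Suc n)
  then obtain j where j: "s j \<le> n" "n < s (Suc j)" by blast
  show ?case
  proof (cases "Suc n < s (Suc j)")
    case True
    with j show ?thesis by (intro exI[of _ j]) linarith
  next
    case False
    with j s_less_Suc[of "Suc j"] show ?thesis by (intro exI[of _ "Suc j"]) linarith
  qed
qed

lemma range_L1: "range (L1 \<alpha>) = range (\<lambda>j. s j + 1)"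
proof (intro equalityI subsetI)
  fix d assume "d \<in> range (L1 \<alpha>)"
  then obtain n where n: "d = L1 \<alpha> n" by auto
  obtain j where "s j \<le> n" "n < s (Suc j)" using ex_plateau by blast
  then show "d \<in> range (\<lambda>j. s j + 1)" using n L1_eq by auto
next
  fix d assume "d \<in> range (\<lambda>j. s j + 1)"
  then obtain j where "d = s j + 1" by auto
  then have "d = L1 \<alpha> (s j)" using L1_eq[of j "s j"] s_less_Suc[of j] by simp
  then show "d \<in> range (L1 \<alpha>)" by simp
qed

lemma infinite_range_L1: "infinite (range (L1 \<alpha>))"
  unfolding range_L1
  by (rule range_inj_infinite) (use strict_mono_eq[OF strict_mono_s] in \<open>auto simp: inj_def\<close>)

lemma d1_eq: "d1 \<alpha> (Suc j) = s j + 1"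
proof -
  have "strict_mono (\<lambda>j. s j + 1)" using strict_mono_s by (simp add: strict_mono_def)
  then show ?thesis by (simp add: d1_def range_L1 enumerate_range_strict_mono)
qed

lemma plateau_eq: "plateau \<alpha> (Suc j) = {s j..<s (Suc j)}"
proof (intro equalityI subsetI)
  fix n assume "n \<in> plateau \<alpha> (Suc j)"
  then have n: "L1 \<alpha> n = s j + 1" by (simp add: plateau_def d1_eq)
  obtain i where i: "s i \<le> n" "n < s (Suc i)" using ex_plateau by blast
  then have "i = j" using n L1_eq strict_mono_eq[OF strict_mono_s, of i j] by simp
  then show "n \<in> {s j..<s (Suc j)}" using i by simp
qed (auto simp: plateau_def d1_eq L1_eq)

lemma J1_eq: "J1 \<alpha> n = of_bool (n + 1 \<in> s ` {1..})"
proof -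
  obtain j where j: "s j \<le> n" "n < s (Suc j)" using ex_plateau by blast
  have Ln: "L1 \<alpha> n = s j + 1" using L1_eq j by simp
  show ?thesis
  proof (cases "n + 1 = s (Suc j)")
    case True
    then have "L1 \<alpha> (n + 1) = s (Suc j) + 1"
      using L1_eq[of "Suc j" "n + 1"] strict_mono_s by (simp add: strict_mono_Suc_iff)
    moreover have "n + 1 \<in> s ` {1..}" using True by auto
    ultimately show ?thesis using Ln True j by (simp add: J1_def)
  next
    case False
    then have "L1 \<alpha> (n + 1) = s j + 1" using L1_eq[of j "n + 1"] j by simp
    moreover have "n + 1 \<notin> s ` {1..}"
    proof
      assume "n + 1 \<in> s ` {1..}"
      then obtain i where "n + 1 = s i" by auto
      with j False have "s j < s i" "s i < s (Suc j)" by auto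
      then show False using strict_mono_less[OF strict_mono_s] by simp
    qed
    ultimately show ?thesis using Ln by (simp add: J1_def)
  qed
qed

lemma expansion_properties:
  "A 0 = 0 \<and> is_cf_expansion A \<alpha> \<and> s 0 = 0 \<and>
   (\<forall>j\<ge>1. s j = (\<Sum>k=1..j. degree (A k))) \<and>
   (\<forall>j\<ge>1. \<forall>n. s (j - 1) \<le> n \<and> n \<le> s j - 1 \<longrightarrow> L1 \<alpha> n = s (j - 1) + 1) \<and>
   infinite (range (L1 \<alpha>)) \<and>
   (\<forall>j\<ge>1. d1 \<alpha> j = s (j - 1) + 1) \<and>
   (\<forall>n. J1 \<alpha> n = of_bool (n + 1 \<in> s ` {1..})) \<and>
   (\<forall>j\<ge>1. card (plateau \<alpha> j) = s j - s (j - 1) \<and> s j - s (j - 1) = degree (A j))"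
proof (intro conjI allI impI)
  show "is_cf_expansion A \<alpha>"
    unfolding is_cf_expansion_def using degree_pos convergents_tendsto by blast
next
  fix j :: nat assume "j \<ge> 1"
  then obtain i where j: "j = Suc i" by (cases j) auto
  show "d1 \<alpha> j = s (j - 1) + 1" by (simp add: j d1_eq)
  show "card (plateau \<alpha> j) = s j - s (j - 1)" by (simp add: j plateau_eq)
  show "s j - s (j - 1) = degree (A j)" by (simp add: j s_Suc)
  show "s j = (\<Sum>k=1..j. degree (A k))" by (rule s_sum)
  fix n assume n: "s (j - 1) \<le> n \<and> n \<le> s j - 1"
  then have "n < s (Suc i)" using s_less_Suc[of i] unfolding j by linarith
  then show "L1 \<alpha> n = s (j - 1) + 1" using n L1_eq[of i n] by (simp add: j)
qed (simp_all add: A_0 s_0 infinite_range_L1 J1_eq)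

end

section \<open>The Gauss map\<close>

definition gauss_map :: "'a::field fls \<Rightarrow> 'a fls" where
  "gauss_map x = frac_part (1 / x)"

lemma gauss_map_in_frak_p: "gauss_map x \<in> frak_p"
  by (simp add: gauss_map_def frac_part_in_frak_p)

text \<open>The first step only separates off \<open>A\<^sub>0 = 0\<close>, so passing to the Gauss map drops \<open>A\<^sub>1\<close>. The shift
  holds from index \<open>1\<close> on, since at index \<open>0\<close> the expansion of the image has \<open>0\<close> in place of \<open>A\<^sub>1\<close>.\<close>

lemma complete_quotient_gauss_map:
  assumes "x \<in> frak_p"
  shows "complete_quotient x (Suc (Suc k)) = complete_quotient (gauss_map x) (Suc k)"
proof (induction k)
  case 0
  show ?case
    by (simp add: complete_quotient_Suc frac_part_frak_p gauss_map_in_frak_p assms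
        gauss_map_def[symmetric])
next
  case (Suc k)
  then show ?case
    by (subst (1 2) complete_quotient_Suc) simp
qed

lemma partial_quotient_gauss_map:
  "x \<in> frak_p \<Longrightarrow> partial_quotient x (Suc (Suc k)) = partial_quotient (gauss_map x) (Suc k)"
  by (simp add: partial_quotient_def complete_quotient_gauss_map)

lemma partial_quotient_1: "x \<in> frak_p \<Longrightarrow> partial_quotient x (Suc 0) = poly_part (1 / x)"
  by (simp add: partial_quotient_def complete_quotient_Suc frac_part_frak_p)

text \<open>The reciprocal of a nonzero series in negative powers of \<open>t\<close> has negative order, so a
  nonconstant polynomial part: from index \<open>1\<close> on, the only way to avoid positive degree is
  termination.\<close>

lemma complete_quotient_zero_or_degree_pos:
  "complete_quotient x (Suc k) = 0 \<or> degree (partial_quotient x (Suc k)) > 0"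
proof (cases "frac_part (complete_quotient x k) = 0")
  case False
  let ?e = "frac_part (complete_quotient x k)"
  have "fls_subdegree ?e \<ge> 1"
    using frac_part_in_frak_p[of "complete_quotient x k"] False by (simp add: frak_p_iff order_ge_iff)
  then have "fls_subdegree (1 / ?e) \<le> - 1" using subdegree_divide[of 1 ?e] False by simp
  then show ?thesis using degree_poly_part_neg_subdegree[of "1 / ?e"]
    by (simp add: partial_quotient_def complete_quotient_Suc)
qed (simp add: complete_quotient_Suc)

lemma partial_quotient_zero_or_degree_pos:
  "partial_quotient x (Suc k) = 0 \<or> degree (partial_quotient x (Suc k)) > 0"
  using complete_quotient_zero_or_degree_pos[of x k]
  by (auto simp: partial_quotient_def)

lemma complete_quotient_zero_mono:
  assumes "complete_quotient x k = 0" "k \<le> m" shows "complete_quotient x m = 0"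
  using assms(2,1)
  by (induction rule: dec_induct) (simp_all add: complete_quotient_Suc frac_part_0)

lemma earlier_partial_quotients_degree_pos:
  assumes "degree (partial_quotient x (Suc k)) > 0" "i \<le> k"
  shows "degree (partial_quotient x (Suc i)) > 0"
proof (rule ccontr)
  assume "\<not> degree (partial_quotient x (Suc i)) > 0"
  then have "complete_quotient x (Suc k) = 0"
    using complete_quotient_zero_or_degree_pos[of x i] complete_quotient_zero_mono assms(2)
    by (meson Suc_le_mono)
  then show False using assms(1) by (simp add: partial_quotient_def)
qed

text \<open>These are the balls of the \<open>t\<^sup>-\<^sup>1\<close>-adic metric inside \<^const>\<open>frak_p\<close>: level \<open>n\<close> fixes the coefficients of
  \<open>t\<^sup>-\<^sup>1, \<dots>, t\<^sup>-\<^sup>n\<close>.\<close>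

definition nbhd :: "nat \<Rightarrow> 'a::field fls \<Rightarrow> 'a fls set" where
  "nbhd n a = {x \<in> frak_p. order_ge (int n + 1) (x - a)}"

lemma nbhd_0: "a \<in> frak_p \<Longrightarrow> nbhd 0 a = frak_p"
  by (auto simp: nbhd_def frak_p_iff order_ge_diff)

text \<open>With \<open>x = 1 / (a + y)\<close> and \<open>x\<^sub>0 = 1 / (a + y\<^sub>0)\<close> one has
  \<open>x - x\<^sub>0 = (y\<^sub>0 - y) / ((a + y) (a + y\<^sub>0))\<close>, and both factors of the denominator have order
  \<open>- deg a\<close>. Conversely, a point \<open>x\<close> of the ball around \<open>x\<^sub>0\<close> has the order \<open>deg a\<close> of \<open>x\<^sub>0\<close>, so that
  \<open>1 / x - 1 / x\<^sub>0\<close> has order \<open>2 deg a\<close> less than \<open>x - x\<^sub>0\<close>.\<close>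

lemma gauss_map_branch:
  fixes y0 :: "'a::field fls"
  assumes a: "degree a > 0" and y0: "y0 \<in> frak_p"
  defines "x0 \<equiv> 1 / (poly_to_fls a + y0)"
  shows "x0 \<in> frak_p"
    and "{x \<in> frak_p. poly_part (1 / x) = a \<and> gauss_map x \<in> nbhd n y0} = nbhd (n + 2 * degree a) x0"
proof -
  let ?h = "int (degree a)"
  have sub: "fls_subdegree (poly_to_fls a + y) = - ?h" "poly_to_fls a + y \<noteq> 0" if "y \<in> frak_p" for y
  proof -
    have "poly_part (poly_to_fls a + y) = a"
      by (rule poly_part_unique[THEN iffD1]) (use that in \<open>simp add: frak_p_iff\<close>)
    then show "fls_subdegree (poly_to_fls a + y) = - ?h"
      using subdegree_via_poly_part[of "poly_to_fls a + y"] a by simp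
    then show "poly_to_fls a + y \<noteq> 0" using a by auto
  qed
  have sx0: "fls_subdegree x0 = ?h" and nz0: "x0 \<noteq> 0"
    using subdegree_divide[of 1 "poly_to_fls a + y0"] sub[OF y0] by (simp_all add: x0_def)
  show x0: "x0 \<in> frak_p" using sx0 a by (simp add: frak_p_iff order_ge_iff)
  show "{x \<in> frak_p. poly_part (1 / x) = a \<and> gauss_map x \<in> nbhd n y0} = nbhd (n + 2 * degree a) x0"
  proof (intro equalityI subsetI)
    fix x assume "x \<in> {x \<in> frak_p. poly_part (1 / x) = a \<and> gauss_map x \<in> nbhd n y0}"
    then have x: "x \<in> frak_p" "poly_part (1 / x) = a" "gauss_map x \<in> nbhd n y0" by auto
    define y where "y = gauss_map x"
    have y: "y \<in> frak_p" "order_ge (int n + 1) (y0 - y)"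
      using x(3) by (auto simp: nbhd_def y_def order_ge_minus_commute)
    have "1 / x = poly_to_fls a + y" using x(2) by (simp add: y_def gauss_map_def frac_part_def)
    then have xe: "x = 1 / (poly_to_fls a + y)" by (metis div_by_1 divide_divide_eq_right mult_1)
    have "x - x0 = (y0 - y) / ((poly_to_fls a + y) * (poly_to_fls a + y0))"
      using sub[OF y(1)] sub[OF y0] by (simp add: xe x0_def divide_simps)
    moreover have "fls_subdegree ((poly_to_fls a + y) * (poly_to_fls a + y0)) = - 2 * ?h"
      using sub[OF y(1)] sub[OF y0] by simp
    ultimately have "order_ge (int n + 1 - (- 2 * ?h)) (x - x0)"
      using order_ge_divide[OF y(2)] by metis
    then show "x \<in> nbhd (n + 2 * degree a) x0"
      using x(1) by (simp add: nbhd_def algebra_simps)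
  next
    fix x assume "x \<in> nbhd (n + 2 * degree a) x0"
    then have x: "x \<in> frak_p" "order_ge (int n + 2 * ?h + 1) (x - x0)"
      by (auto simp: nbhd_def)
    have "order_ge (?h + 1) (x - x0)" using x(2) by (rule order_ge_mono) simp
    then have coeffs: "fls_nth x i = fls_nth x0 i" if "i \<le> ?h" for i
      using that by (auto simp: order_ge_def)
    have sx: "fls_subdegree x = ?h"
      using coeffs nz0 sx0 nth_fls_subdegree_nonzero[OF nz0] by (intro fls_subdegree_eqI) auto
    then have nz: "x \<noteq> 0" using a by auto
    define y where "y = 1 / x - poly_to_fls a"
    have "y - y0 = (x0 - x) / (x * x0)"
    proof -
      have "poly_to_fls a + y0 = 1 / x0" by (simp add: x0_def)
      then have "y - y0 = 1 / x - 1 / x0" by (simp add: y_def algebra_simps)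
      then show ?thesis using nz nz0 by (simp add: field_simps)
    qed
    moreover have "order_ge (int n + 2 * ?h + 1) (x0 - x)" using x(2) order_ge_minus_commute by blast
    moreover have "fls_subdegree (x * x0) = 2 * ?h" using nz nz0 sx sx0 by simp
    ultimately have yy: "order_ge (int n + 1) (y - y0)"
      using order_ge_divide[of "int n + 2 * ?h + 1" "x0 - x" "x * x0"] by (simp add: algebra_simps)
    then have "order_ge 1 (y - y0 + y0)"
      using y0 by (intro order_ge_add) (auto simp: frak_p_iff intro: order_ge_mono)
    then have yp: "order_ge 1 y" by simp
    then have "poly_part (1 / x) = a" by (simp add: poly_part_unique[symmetric] y_def)
    moreover from this have "gauss_map x = y" by (simp add: gauss_map_def frac_part_def y_def)
    ultimately show "x \<in> {x \<in> frak_p. poly_part (1 / x) = a \<and> gauss_map x \<in> nbhd n y0}"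
      using x(1) yp yy by (simp add: nbhd_def frak_p_iff)
  qed
qed

text \<open>Induction on the number of prescribed quotients, one branch of the inverse Gauss map per
  step.\<close>

lemma cylinder_eq_nbhd:
  fixes a :: "nat \<Rightarrow> 'a::field poly"
  assumes "\<And>i. i < k \<Longrightarrow> degree (a i) > 0"
  shows "\<exists>x0\<in>frak_p. {x \<in> frak_p. \<forall>i<k. partial_quotient x (Suc i) = a i}
           = nbhd (2 * (\<Sum>i<k. degree (a i))) x0"
  using assms
proof (induction k arbitrary: a)
  case 0
  have "(0 :: 'a fls) \<in> frak_p" by (simp add: frak_p_def)
  then show ?case using nbhd_0 by force
next
  case (Suc k)
  obtain y0 where y0: "y0 \<in> frak_p"
    and cyl: "{x \<in> frak_p. \<forall>i<k. partial_quotient x (Suc i) = a (Suc i)}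
       = nbhd (2 * (\<Sum>i<k. degree (a (Suc i)))) y0"
    using Suc.IH[of "\<lambda>i. a (Suc i)"] Suc.prems by auto
  let ?n = "2 * (\<Sum>i<k. degree (a (Suc i)))"
  have "{x \<in> frak_p. \<forall>i<Suc k. partial_quotient x (Suc i) = a i}
      = {x \<in> frak_p. poly_part (1 / x) = a 0 \<and> gauss_map x \<in> nbhd ?n y0}"
    by (auto simp: cyl[symmetric] All_less_Suc2 partial_quotient_1 partial_quotient_gauss_map gauss_map_in_frak_p)
  also have "\<dots> = nbhd (?n + 2 * degree (a 0)) (1 / (poly_to_fls (a 0) + y0))"
    by (rule gauss_map_branch(2)[OF _ y0]) (use Suc.prems in simp)
  also have "?n + 2 * degree (a 0) = 2 * (\<Sum>i<Suc k. degree (a i))"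
    by (subst sum.lessThan_Suc_shift) simp
  finally show ?case
    using gauss_map_branch(1)[OF Suc.prems y0, of 0] by blast
qed

section \<open>Haar measure of balls\<close>

lemma open_order_ge: "open {x. order_ge (int n + 1) (x - a)}"
  unfolding open_dist
proof (intro ballI exI conjI allI impI)
  show "(0::real) < inverse (2 ^ n)" by simp
next
  fix x y :: "'a fls" assume x: "x \<in> {x. order_ge (int n + 1) (x - a)}" and d: "dist y x < inverse (2 ^ n)"
  have "order_ge (int n + 1) (y - x)"
  proof (cases "y = x")
    case False
    show ?thesis
    proof (cases "fls_subdegree (y - x) \<ge> 0")
      case True
      then have "inverse ((2::real) ^ nat (fls_subdegree (y - x))) < inverse (2 ^ n)"
        using d False by (simp add: dist_fls_def)
      then have "(2::real) ^ n < 2 ^ nat (fls_subdegree (y - x))" by simp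
      then have "n < nat (fls_subdegree (y - x))" by simp
      then have "int n + 1 \<le> fls_subdegree (y - x)" by linarith
      then show ?thesis by (simp add: order_ge_iff)
    next
      case neg: False
      then have "(2::real) ^ nat (- fls_subdegree (y - x)) < inverse (2 ^ n)"
        using d False by (simp add: dist_fls_def)
      moreover have "inverse ((2::real) ^ n) \<le> 1" "(1::real) \<le> 2 ^ nat (- fls_subdegree (y - x))"
        by (simp_all add: inverse_le_1_iff)
      ultimately show ?thesis by linarith
    qed
  qed (simp add: order_ge_def)
  with x have "order_ge (int n + 1) ((y - x) + (x - a))" by (intro order_ge_add) auto
  then show "y \<in> {x. order_ge (int n + 1) (x - a)}" by simp
qed

locale haar_space =
  fixes M :: "'a::{field,finite} fls measure"
  assumes haar: "haar_prob M"

sublocale haar_space \<subseteq> prob_space M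
  using haar by (simp add: haar_prob_def)

context haar_space
begin

lemma space_M: "space M = frak_p"
  using haar by (simp add: haar_prob_def)

lemma nbhd_sets: "nbhd n a \<in> sets M"
proof -
  have "nbhd n a = {x. order_ge (int n + 1) (x - a)} \<inter> frak_p" by (auto simp: nbhd_def)
  moreover have "sets M = sets (restrict_space borel frak_p)" using haar by (simp add: haar_prob_def)
  ultimately show ?thesis using open_order_ge[of n a] by (auto simp: sets_restrict_space)
qed

lemma measure_translate_nbhd:
  assumes "b \<in> frak_p" shows "measure M (nbhd n (b + a)) = measure M (nbhd n a)"
proof -
  have "nbhd n (b + a) = (+) b ` nbhd n a"
  proof (intro equalityI subsetI)
    fix x assume "x \<in> nbhd n (b + a)"
    then have "x - b \<in> nbhd n a" using assms by (auto simp: nbhd_def frak_p_iff order_ge_diff algebra_simps)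
    then show "x \<in> (+) b ` nbhd n a" by (intro image_eqI[of _ _ "x - b"]) auto
  next
    fix x assume "x \<in> (+) b ` nbhd n a"
    then show "x \<in> nbhd n (b + a)" using assms by (auto simp: nbhd_def frak_p_iff order_ge_add algebra_simps)
  qed
  then show ?thesis using haar assms nbhd_sets by (simp add: haar_prob_def measure_def)
qed

text \<open>A ball of level \<open>n\<close> is the disjoint union of \<open>q\<close> translates of a ball of level \<open>n + 1\<close>, one for
  each value of the next coefficient.\<close>

lemma measure_nbhd:
  assumes "a \<in> frak_p" shows "measure M (nbhd n a) = 1 / real CARD('a) ^ n"
  using assms
proof (induction n arbitrary: a)
  case 0
  then show ?case using prob_space by (simp add: nbhd_0 space_M)
next
  case (Suc n)
  define u :: "'a \<Rightarrow> 'a fls" where "u c = fls_shift (- int (Suc n)) (fls_const c)" for c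
  have nth_u: "fls_nth (u c) i = (if i = int (Suc n) then c else 0)" for c i
    by (auto simp: u_def)
  have u: "u c \<in> frak_p" for c by (auto simp: frak_p_def nth_u)
  have split: "x \<in> nbhd (Suc n) (u c + a) \<longleftrightarrow> x \<in> nbhd n a \<and> c = fls_nth (x - a) (int (Suc n))" for x c
  proof -
    have "order_ge (int (Suc n) + 1) (x - (u c + a)) \<longleftrightarrow>
       order_ge (int n + 1) (x - a) \<and> c = fls_nth (x - a) (int (Suc n))"
      unfolding order_ge_def
    proof (safe)
      assume *: "\<forall>i<int (Suc n) + 1. fls_nth (x - (u c + a)) i = 0"
      show "c = fls_nth (x - a) (int (Suc n))" using *[rule_format, of "int (Suc n)"] by (simp add: nth_u algebra_simps)
      fix i assume "i < int n + 1"
      then show "fls_nth (x - a) i = 0" using *[rule_format, of i] by (simp add: nth_u)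
    next
      fix i assume *: "\<forall>i<int n + 1. fls_nth (x - a) i = 0" "i < int (Suc n) + 1" "c = fls_nth (x - a) (int (Suc n))"
      show "fls_nth (x - (u (fls_nth (x - a) (int (Suc n))) + a)) i = 0"
        using *(1)[rule_format, of i] *(2) by (cases "i = int (Suc n)") (auto simp: nth_u)
    qed
    then show ?thesis by (auto simp: nbhd_def)
  qed
  have "measure M (nbhd n a) = measure M (\<Union>c\<in>UNIV. nbhd (Suc n) (u c + a))"
    by (rule arg_cong[where f = "measure M"]) (auto simp: split)
  also have "\<dots> = (\<Sum>c\<in>UNIV. measure M (nbhd (Suc n) (u c + a)))"
    by (rule finite_measure_finite_Union) (auto simp: disjoint_family_on_def split nbhd_sets)
  also have "\<dots> = real CARD('a) * measure M (nbhd (Suc n) a)"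
    by (simp add: measure_translate_nbhd u)
  finally show ?case using Suc by (simp add: field_simps)
qed

end

section \<open>The law of the partial quotients\<close>

lemma countable_polys: "countable (UNIV :: 'a::{zero,finite} poly set)"
proof -
  have "UNIV = range (Poly :: 'a list \<Rightarrow> 'a poly)" by (metis Poly_coeffs surj_def)
  then show ?thesis by (metis countable_image countableI_type)
qed

text \<open>Domination on points passes to all subsets of a countable space, in particular to complements,
  where equal total mass reverses it. Domination is what the joint law satisfies at sight; equality on
  the points where the dominated measure vanishes comes out as a consequence.\<close>

lemma prob_space_eqI_singletons:
  assumes "prob_space \<mu>" "prob_space \<nu>" and sets: "sets \<mu> = Pow \<Omega>" "sets \<nu> = Pow \<Omega>"
    and "countable \<Omega>" and le: "\<And>a. a \<in> \<Omega> \<Longrightarrow> emeasure \<mu> {a} \<le> emeasure \<nu> {a}"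
  shows "\<mu> = \<nu>"
proof (rule measure_eqI)
  interpret \<mu>: prob_space \<mu> by fact
  interpret \<nu>: prob_space \<nu> by fact
  have sp: "space \<mu> = \<Omega>" "space \<nu> = \<Omega>" using sets sets_eq_imp_space_eq[of _ "count_space \<Omega>"] by auto
  have le': "measure \<mu> X \<le> measure \<nu> X" if "X \<subseteq> \<Omega>" for X
  proof -
    have "countable X" using that assms(5) countable_subset by blast
    then have "emeasure \<mu> X = (\<integral>\<^sup>+x. emeasure \<mu> {x} \<partial>count_space X)"
      "emeasure \<nu> X = (\<integral>\<^sup>+x. emeasure \<nu> {x} \<partial>count_space X)"
      using that by (auto intro!: emeasure_countable_singleton simp: sets)
    moreover have "(\<integral>\<^sup>+x. emeasure \<mu> {x} \<partial>count_space X) \<le> (\<integral>\<^sup>+x. emeasure \<nu> {x} \<partial>count_space X)"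
      by (rule nn_integral_mono) (use that le in auto)
    ultimately have "emeasure \<mu> X \<le> emeasure \<nu> X" by simp
    then show ?thesis by (simp add: \<mu>.emeasure_eq_measure \<nu>.emeasure_eq_measure)
  qed
  fix X assume X: "X \<in> sets \<mu>"
  then have "measure \<mu> (\<Omega> - X) = 1 - measure \<mu> X" "measure \<nu> (\<Omega> - X) = 1 - measure \<nu> X"
    using \<mu>.prob_compl[of X] \<nu>.prob_compl[of X] sets sp by auto
  moreover have "X \<subseteq> \<Omega>" using X sets by simp
  ultimately have "measure \<mu> X = measure \<nu> X" using le'[of X] le'[of "\<Omega> - X"] by simp
  then show "emeasure \<mu> X = emeasure \<nu> X" by (simp add: \<mu>.emeasure_eq_measure \<nu>.emeasure_eq_measure)
qed (use sets in simp)

context haar_space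
begin

lemma measure_cylinder:
  assumes "\<And>i. i < k \<Longrightarrow> degree (a i) > 0"
  shows "{x \<in> space M. \<forall>i<k. partial_quotient x (Suc i) = a i} \<in> sets M"
    and "measure M {x \<in> space M. \<forall>i<k. partial_quotient x (Suc i) = a i}
      = (\<Prod>i<k. 1 / real CARD('a) ^ (2 * degree (a i)))"
proof -
  obtain x0 where x0: "x0 \<in> frak_p" "{x \<in> frak_p. \<forall>i<k. partial_quotient x (Suc i) = a i}
           = nbhd (2 * (\<Sum>i<k. degree (a i))) x0"
    using cylinder_eq_nbhd[of k a] assms by auto
  show "{x \<in> space M. \<forall>i<k. partial_quotient x (Suc i) = a i} \<in> sets M"
    unfolding space_M x0(2) by (rule nbhd_sets)
  show "measure M {x \<in> space M. \<forall>i<k. partial_quotient x (Suc i) = a i}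
      = (\<Prod>i<k. 1 / real CARD('a) ^ (2 * degree (a i)))"
    unfolding space_M x0(2)
    by (simp add: measure_nbhd x0(1) prod_dividef power_sum sum_distrib_left)
qed

text \<open>If \<open>A\<^sub>k\<^sub>+\<^sub>1\<close> has positive degree then so have \<open>A\<^sub>1, \<dots>, A\<^sub>k\<close>, so the event
  that \<open>A\<^sub>k\<^sub>+\<^sub>1\<close> is a given polynomial of positive degree is a countable union of cylinders. The only
  other possible value is \<open>0\<close>, taken on the complement of these events.\<close>

lemma partial_quotient_measurable:
  "(\<lambda>x. partial_quotient x (Suc k)) \<in> measurable M (count_space UNIV)"
  unfolding measurable_count_space_eq_countable[OF countable_polys]
proof (intro conjI ballI)
  define fib where "fib a = {x \<in> space M. partial_quotient x (Suc k) = a}" for a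
  have pos: "fib a \<in> sets M" if a: "degree a > 0" for a
  proof -
    let ?F = "{f \<in> PiE {..<Suc k} (\<lambda>_. UNIV). f k = a \<and> (\<forall>i<Suc k. degree (f i) > 0)}"
    let ?C = "\<lambda>f. {x \<in> space M. \<forall>i<Suc k. partial_quotient x (Suc i) = f i}"
    have "fib a = (\<Union>f\<in>?F. ?C f)"
    proof (intro equalityI subsetI)
      fix x assume x: "x \<in> fib a"
      let ?f = "\<lambda>i\<in>{..<Suc k}. partial_quotient x (Suc i)"
      have "?f \<in> ?F" using x a earlier_partial_quotients_degree_pos[of x k] by (auto simp: fib_def)
      moreover have "x \<in> ?C ?f" using x by (auto simp: fib_def)
      ultimately show "x \<in> (\<Union>f\<in>?F. ?C f)" by blast
    qed (auto simp: fib_def)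
    moreover have "countable ?F"
      by (rule countable_subset[of _ "PiE {..<Suc k} (\<lambda>_. UNIV)"]) (auto intro!: countable_PiE countable_polys)
    ultimately show ?thesis
      by (auto intro!: sets.countable_UN' measure_cylinder(1))
  qed
  fix a :: "'a poly"
  consider "degree a > 0" | "a = 0" | "degree a = 0" "a \<noteq> 0" by blast
  then have "fib a \<in> sets M"
  proof cases
    case 2
    have "fib 0 = space M - (\<Union>a\<in>{a. degree a > 0}. fib a)"
      using partial_quotient_zero_or_degree_pos[of _ k] by (auto simp: fib_def)
    also have "\<dots> \<in> sets M"
      by (intro sets.Diff sets.top sets.countable_UN' countable_subset[OF _ countable_polys]) (auto simp: pos)
    finally show ?thesis using 2 by simp
  next
    case 3
    have "partial_quotient x (Suc k) \<noteq> a" for x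
      using partial_quotient_zero_or_degree_pos[of x k] 3 by auto
    then have "fib a = {}" by (simp add: fib_def)
    then show ?thesis by simp
  qed (rule pos)
  moreover have "(\<lambda>x. partial_quotient x (Suc k)) -` {a} \<inter> space M = fib a" by (auto simp: fib_def)
  ultimately show "(\<lambda>x. partial_quotient x (Suc k)) -` {a} \<inter> space M \<in> sets M" by simp
qed simp

lemma partial_quotient_measurable':
  "j \<ge> 1 \<Longrightarrow> (\<lambda>x. partial_quotient x j) \<in> measurable M (count_space UNIV)"
  using partial_quotient_measurable[of "j - 1"] by simp

text \<open>Taking the law of \<open>A\<^sub>1\<close> itself, rather than the weights \<open>q\<^bsup>-2 deg a\<^esup>\<close>, makes it a probability
  measure without summing over all polynomials.\<close>

definition quotient_law :: "'a poly measure" where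
  "quotient_law = distr M (count_space UNIV) (\<lambda>x. partial_quotient x 1)"

lemma sets_quotient_law [measurable_cong, simp]: "sets quotient_law = sets (count_space UNIV)"
  and space_quotient_law [simp]: "space quotient_law = UNIV"
  by (simp_all add: quotient_law_def)

lemma prob_space_quotient_law: "prob_space quotient_law"
  unfolding quotient_law_def by (rule prob_space_distr) (simp add: partial_quotient_measurable')

lemma measure_quotient_law: "measure quotient_law S = measure M {x \<in> space M. partial_quotient x 1 \<in> S}"
  unfolding quotient_law_def
  by (subst measure_distr) (auto simp: partial_quotient_measurable' intro!: arg_cong[where f = "measure M"])

text \<open>The order of \<open>1 / x\<close> is the negative of that of \<open>x\<close>, and \<open>A\<^sub>1\<close> is the polynomial part of \<open>1 / x\<close>.\<close>

lemma degree_first: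
  assumes "x \<in> frak_p" "x \<noteq> 0" shows "int (degree (partial_quotient x 1)) = fls_subdegree x"
  using degree_poly_part_neg_subdegree[of "1 / x"] subdegree_divide[of 1 x] assms
  by (simp add: partial_quotient_1 frak_p_iff order_ge_iff)

lemma measure_quotient_law_degree:
  assumes "h \<ge> 1"
  shows "measure quotient_law {a. degree a = h} = (real CARD('a) - 1) / real CARD('a) ^ h"
proof -
  have z: "(0 :: 'a fls) \<in> frak_p" by (simp add: frak_p_def)
  have "degree (partial_quotient x 1) = h \<longleftrightarrow> x \<in> nbhd (h - 1) 0 - nbhd h 0" if x: "x \<in> frak_p" for x
  proof (cases "x = 0")
    case True
    then show ?thesis using z assms x by (simp add: partial_quotient_1 nbhd_def order_ge_def poly_part_frak_p)
  next
    case False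
    then show ?thesis using degree_first[OF x False] x assms by (auto simp: nbhd_def order_ge_iff)
  qed
  then have "measure quotient_law {a. degree a = h} = measure M (nbhd (h - 1) 0 - nbhd h 0)"
    unfolding measure_quotient_law by (intro arg_cong[where f = "measure M"]) (auto simp: space_M nbhd_def)
  also have "\<dots> = measure M (nbhd (h - 1) 0) - measure M (nbhd h 0)"
    by (rule finite_measure_Diff[OF nbhd_sets nbhd_sets]) (auto simp: nbhd_def intro: order_ge_mono)
  also have "\<dots> = (real CARD('a) - 1) / real CARD('a) ^ h"
    using assms by (cases h) (simp_all add: measure_nbhd z field_simps)
  finally show ?thesis .
qed

lemma CARD_ge_2: "CARD('a) \<ge> 2"
  using card_mono[of UNIV "{0, 1 :: 'a}"] by simp

text \<open>The first partial quotient is constant only at \<open>0\<close>, which lies in balls of arbitrarily small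
  measure.\<close>

lemma measure_quotient_law_degree_0: "measure quotient_law {a. degree a = 0} = 0"
proof -
  have z: "(0 :: 'a fls) \<in> frak_p" by (simp add: frak_p_def)
  have le: "measure quotient_law {a. degree a = 0} \<le> (1 / real CARD('a)) ^ n" for n
  proof -
    have "x \<in> nbhd n 0" if "x \<in> frak_p" "degree (partial_quotient x 1) = 0" for x :: "'a fls"
    proof (cases "x = 0")
      case False
      then show ?thesis using degree_first[OF that(1) False] that by (simp add: frak_p_iff order_ge_iff)
    qed (use z in \<open>simp add: nbhd_def order_ge_def\<close>)
    then have "measure quotient_law {a. degree a = 0} \<le> measure M (nbhd n 0)"
      unfolding measure_quotient_law by (intro finite_measure_mono nbhd_sets) (auto simp: space_M)
    then show ?thesis by (simp add: measure_nbhd z power_one_over)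
  qed
  have "(\<lambda>n. (1 / real CARD('a)) ^ n) \<longlonglongrightarrow> 0"
    using CARD_ge_2 by (intro LIMSEQ_realpow_zero) auto
  then have "measure quotient_law {a. degree a = 0} \<le> 0"
    by (rule LIMSEQ_le_const) (use le in auto)
  then show ?thesis by (simp add: measure_le_0_iff)
qed

lemma measure_quotient_law_singleton:
  "measure quotient_law {a} = (if degree a > 0 then 1 / real CARD('a) ^ (2 * degree a) else 0)"
proof (cases "degree a > 0")
  case True
  then show ?thesis using measure_cylinder(2)[of 1 "\<lambda>_. a"] by (simp add: measure_quotient_law)
next
  case False
  interpret L: prob_space quotient_law by (rule prob_space_quotient_law)
  have "measure quotient_law {a} \<le> measure quotient_law {a. degree a = 0}"
    by (rule L.finite_measure_mono) (use False in auto)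
  then show ?thesis using False by (simp add: measure_quotient_law_degree_0 measure_le_0_iff)
qed

text \<open>The product measure is compared with the joint law point by point: on points with coordinates of
  positive degree both have the mass of a cylinder, elsewhere the product measure vanishes.\<close>

lemma joint_law:
  "distr M (PiM {1..k} (\<lambda>_. count_space UNIV)) (\<lambda>x. \<lambda>i\<in>{1..k}. partial_quotient x i)
    = PiM {1..k} (\<lambda>_. quotient_law)"
    (is "?L = ?R")
proof (rule sym, rule prob_space_eqI_singletons)
  interpret L: prob_space quotient_law by (rule prob_space_quotient_law)
  interpret product_sigma_finite "\<lambda>_::nat. quotient_law"
    by (simp add: product_sigma_finite_def L.sigma_finite_measure)
  have meas: "(\<lambda>x. \<lambda>i\<in>{1..k}. partial_quotient x i) \<in> measurable M (PiM {1..k} (\<lambda>_. count_space UNIV))"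
    by (rule measurable_restrict) (simp add: partial_quotient_measurable')
  show "prob_space ?L" by (rule prob_space_distr[OF meas])
  show "prob_space ?R" by (rule prob_space_PiM) (rule prob_space_quotient_law)
  have cs: "PiM {1..k} (\<lambda>_. count_space UNIV) = count_space (PiE {1..k} (\<lambda>_. UNIV :: 'a poly set))"
    by (rule count_space_PiM_finite) (auto simp: countable_polys)
  show "sets ?L = Pow (PiE {1..k} (\<lambda>_. UNIV))" by (simp only: sets_distr cs) simp
  have "sets ?R = sets (PiM {1..k} (\<lambda>_. count_space (UNIV :: 'a poly set)))"
    by (rule sets_PiM_cong) auto
  then show "sets ?R = Pow (PiE {1..k} (\<lambda>_. UNIV))" by (simp only: cs) simp
  show "countable (PiE {1..k} (\<lambda>_. UNIV :: 'a poly set))"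
    by (rule countable_PiE) (auto simp: countable_polys)
  fix f assume f: "f \<in> PiE {1..k} (\<lambda>_. UNIV :: 'a poly set)"
  then have "f \<in> extensional {1..k}" by (simp add: PiE_def)
  then have "{f} = PiE {1..k} (\<lambda>i. {f i})" by (rule PiE_singleton[symmetric])
  then have "emeasure ?R {f} = (\<Prod>i\<in>{1..k}. emeasure quotient_law {f i})"
    by (simp add: emeasure_PiM)
  also have "\<dots> = ennreal (\<Prod>i\<in>{1..k}. measure quotient_law {f i})"
    by (simp add: L.emeasure_eq_measure prod_ennreal)
  also have "\<dots> \<le> emeasure ?L {f}"
  proof (cases "\<forall>i\<in>{1..k}. degree (f i) > 0")
    case True
    have img: "{1..k} = Suc ` {..<k}" by (auto simp: image_Suc_lessThan)
    have "(\<Prod>i\<in>{1..k}. measure quotient_law {f i}) = (\<Prod>i<k. 1 / real CARD('a) ^ (2 * degree (f (Suc i))))"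
      using True unfolding img by (simp add: prod.reindex measure_quotient_law_singleton)
    also have "\<dots> = measure M {x \<in> space M. \<forall>i<k. partial_quotient x (Suc i) = f (Suc i)}"
      by (rule measure_cylinder(2)[symmetric]) (use True in auto)
    also have "{x \<in> space M. \<forall>i<k. partial_quotient x (Suc i) = f (Suc i)}
        = (\<lambda>x. \<lambda>i\<in>{1..k}. partial_quotient x i) -` {f} \<inter> space M"
    proof -
      have "(\<lambda>i\<in>{1..k}. partial_quotient x i) = f \<longleftrightarrow> (\<forall>i<k. partial_quotient x (Suc i) = f (Suc i))" for x
      proof -
        have "(\<lambda>i\<in>{1..k}. partial_quotient x i) = f \<longleftrightarrow> (\<forall>i\<in>{1..k}. partial_quotient x i = f i)"
          using f by (auto simp: fun_eq_iff PiE_def extensional_def restrict_def)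
        then show ?thesis unfolding img by auto
      qed
      then show ?thesis by auto
    qed
    also have "ennreal (measure M \<dots>) = emeasure ?L {f}"
    proof -
      have "{f} \<in> sets (PiM {1..k} (\<lambda>_. count_space UNIV))" unfolding cs using f by simp
      then show ?thesis using meas by (simp only: emeasure_distr emeasure_eq_measure)
    qed
    finally show ?thesis by (rule eq_refl)
  next
    case False
    then have "(\<Prod>i\<in>{1..k}. measure quotient_law {f i}) = 0" by (auto simp: measure_quotient_law_singleton)
    then show ?thesis by (simp only: ennreal_0 zero_le)
  qed
  finally show "emeasure ?R {f} \<le> emeasure ?L {f}" .
qed

text \<open>Each law is a marginal of the joint law, and the marginals of the product measure are all equal.\<close>

lemma identically_distributed:
  assumes "j \<ge> 1" shows "distr M (count_space UNIV) (\<lambda>x. partial_quotient x j) = quotient_law"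
proof -
  let ?X = "\<lambda>x. \<lambda>i\<in>{1..j}. partial_quotient x i"
  have "quotient_law = distr (PiM {1..j} (\<lambda>_. quotient_law)) quotient_law (\<lambda>\<omega>. \<omega> j)"
    using assms by (intro distr_PiM_component[symmetric] prob_space_quotient_law) auto
  also have "\<dots> = distr (distr M (PiM {1..j} (\<lambda>_. count_space UNIV)) ?X) (count_space UNIV) (\<lambda>\<omega>. \<omega> j)"
    unfolding joint_law by (rule distr_cong) auto
  also have "\<dots> = distr M (count_space UNIV) ((\<lambda>\<omega>. \<omega> j) \<circ> ?X)"
    using assms by (intro distr_distr measurable_component_singleton measurable_restrict partial_quotient_measurable') auto
  also have "(\<lambda>\<omega>. \<omega> j) \<circ> ?X = (\<lambda>x. partial_quotient x j)" using assms by auto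
  finally show ?thesis by simp
qed

text \<open>Independence of an infinite family is a statement about finite subfamilies, each contained in an
  initial segment \<open>A\<^sub>1, \<dots>, A\<^sub>m\<close>.\<close>

lemma indep_partial_quotients:
  "indep_vars (\<lambda>_. count_space UNIV) (\<lambda>j x. partial_quotient x j) {1..}"
proof -
  have fin: "indep_vars (\<lambda>_. count_space UNIV) (\<lambda>j x. partial_quotient x j) J"
    if J: "J \<subseteq> {1..}" "J \<noteq> {}" "finite J" for J
  proof -
    obtain m where "J \<subseteq> {..m}" using J(3) by (metis finite_nat_iff_bounded_le)
    with J(1) have J': "J \<subseteq> {1..m}" by auto
    have "PiM {1..m} (\<lambda>i. distr M (count_space UNIV) (\<lambda>x. partial_quotient x i)) = PiM {1..m} (\<lambda>_. quotient_law)"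
      by (rule PiM_cong) (simp_all add: identically_distributed)
    moreover have "{1..m} \<noteq> {}" using J' J(2) by auto
    ultimately have "indep_vars (\<lambda>_. count_space UNIV) (\<lambda>j x. partial_quotient x j) {1..m}"
      using joint_law[of m] by (subst indep_vars_iff_distr_eq_PiM') (simp_all add: partial_quotient_measurable')
    then show ?thesis using J' by (rule indep_vars_subset)
  qed
  then show ?thesis
    unfolding indep_vars_def2
    by (subst indep_sets_finite_index_sets) (auto simp: partial_quotient_measurable')
qed

lemma measure_degree:
  assumes "j \<ge> 1"
  shows "measure M {x \<in> space M. degree (partial_quotient x j) = h} = measure quotient_law {a. degree a = h}"
  unfolding identically_distributed[OF assms, symmetric]
  by (subst measure_distr)
    (use assms in \<open>auto simp: partial_quotient_measurable' intro!: arg_cong[where f = "measure M"]\<close>)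

lemma AE_infinite_cf: "AE \<alpha> in M. infinite_cf \<alpha>"
proof -
  have "AE x in M. degree (partial_quotient x j) > 0" if "j \<ge> 1" for j
  proof (rule AE_I)
    show "{x \<in> space M. \<not> degree (partial_quotient x j) > 0} \<subseteq> {x \<in> space M. degree (partial_quotient x j) = 0}"
      by auto
    show "emeasure M {x \<in> space M. degree (partial_quotient x j) = 0} = 0"
      using measure_degree[OF that, of 0] by (simp add: emeasure_eq_measure measure_quotient_law_degree_0)
    have "(\<lambda>x. partial_quotient x j) -` {a. degree a = 0} \<inter> space M \<in> sets M"
      by (rule measurable_sets[OF partial_quotient_measurable'[OF that]]) simp
    also have "(\<lambda>x. partial_quotient x j) -` {a. degree a = 0} \<inter> space M
        = {x \<in> space M. degree (partial_quotient x j) = 0}" by auto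
    finally show "{x \<in> space M. degree (partial_quotient x j) = 0} \<in> sets M" .
  qed
  then have "AE x in M. \<forall>j\<in>{1..}. degree (partial_quotient x j) > 0"
    by (subst AE_ball_countable) auto
  with AE_space show ?thesis
    by eventually_elim (auto simp: infinite_cf_def space_M)
qed

end

theorem proposition1p2:
  fixes M :: "'a::{field,finite} fls measure" and q :: nat
  assumes q: "q = CARD('a)"
    and haar: "haar_prob M"
  shows "(AE \<alpha> in M.
            partial_quotient \<alpha> 0 = 0 \<and> is_cf_expansion (partial_quotient \<alpha>) \<alpha> \<and>
            cf_deg \<alpha> 0 = 0 \<and>
            (\<forall>j\<ge>1. cf_deg \<alpha> j = (\<Sum>k=1..j. degree (partial_quotient \<alpha> k))) \<and>
            (\<forall>j\<ge>1. \<forall>n. cf_deg \<alpha> (j - 1) \<le> n \<and> n \<le> cf_deg \<alpha> j - 1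
                \<longrightarrow> L1 \<alpha> n = cf_deg \<alpha> (j - 1) + 1) \<and>
            infinite (range (L1 \<alpha>)) \<and>
            (\<forall>j\<ge>1. d1 \<alpha> j = cf_deg \<alpha> (j - 1) + 1) \<and>
            (\<forall>n. J1 \<alpha> n = of_bool (n + 1 \<in> cf_deg \<alpha> ` {1..})) \<and>
            (\<forall>j\<ge>1. card (plateau \<alpha> j) = cf_deg \<alpha> j - cf_deg \<alpha> (j - 1) \<and>
                    cf_deg \<alpha> j - cf_deg \<alpha> (j - 1) = degree (partial_quotient \<alpha> j)))
       \<and> prob_space.indep_vars M (\<lambda>_. count_space UNIV) (\<lambda>j \<alpha>. partial_quotient \<alpha> j) {1..}
       \<and> (\<forall>j\<ge>1. distr M (count_space UNIV) (\<lambda>\<alpha>. partial_quotient \<alpha> j)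
               = distr M (count_space UNIV) (\<lambda>\<alpha>. partial_quotient \<alpha> 1))
       \<and> (\<forall>j\<ge>1. \<forall>h\<ge>1.
            measure M {\<alpha> \<in> space M. degree (partial_quotient \<alpha> j) = h}
              = (real q - 1) * real q powi (- int h) \<and>
            (real q - 1) * real q powi (- int h)
              = (1 - real q powi (-1)) * real q powi (- (int h - 1)))"
proof -
  interpret haar_space M by (rule haar_space.intro) (rule haar)
  have q2: "real q \<ge> 2" using CARD_ge_2 by (simp add: q)
  have identity: "(real q - 1) * real q powi (- int h)
      = (1 - real q powi (-1)) * real q powi (- (int h - 1))" if "h \<ge> 1" for h
  proof -
    obtain m where m: "h = Suc m" using \<open>h \<ge> 1\<close> by (cases h) auto
    then have "int h - 1 = int m" by simp
    then show ?thesis using q2 by (simp only: m power_int_minus power_int_of_nat) (simp add: field_simps)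
  qed
  have degree_law: "measure M {\<alpha> \<in> space M. degree (partial_quotient \<alpha> j) = h}
      = (real q - 1) * real q powi (- int h)" if "j \<ge> 1" "h \<ge> 1" for j h
    using that by (simp add: measure_degree measure_quotient_law_degree q power_int_minus divide_inverse)
  show ?thesis
  proof (intro conjI allI impI)
    show "AE \<alpha> in M.
            partial_quotient \<alpha> 0 = 0 \<and> is_cf_expansion (partial_quotient \<alpha>) \<alpha> \<and>
            cf_deg \<alpha> 0 = 0 \<and>
            (\<forall>j\<ge>1. cf_deg \<alpha> j = (\<Sum>k=1..j. degree (partial_quotient \<alpha> k))) \<and>
            (\<forall>j\<ge>1. \<forall>n. cf_deg \<alpha> (j - 1) \<le> n \<and> n \<le> cf_deg \<alpha> j - 1
                \<longrightarrow> L1 \<alpha> n = cf_deg \<alpha> (j - 1) + 1) \<and>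
            infinite (range (L1 \<alpha>)) \<and>
            (\<forall>j\<ge>1. d1 \<alpha> j = cf_deg \<alpha> (j - 1) + 1) \<and>
            (\<forall>n. J1 \<alpha> n = of_bool (n + 1 \<in> cf_deg \<alpha> ` {1..})) \<and>
            (\<forall>j\<ge>1. card (plateau \<alpha> j) = cf_deg \<alpha> j - cf_deg \<alpha> (j - 1) \<and>
                    cf_deg \<alpha> j - cf_deg \<alpha> (j - 1) = degree (partial_quotient \<alpha> j))"
      using AE_infinite_cf by eventually_elim (rule infinite_cf.expansion_properties)
  qed (simp_all only: indep_partial_quotients identically_distributed degree_law identity order_refl)
qed

end
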